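(* If $\nu\in\mathbb Y$ and $(z,z')\in\mathbb C^2$ are fixed while $\varepsilon\to0$ ($\varepsilon\in\mathbb C\setminus\{0\}$), then $$FS^{(\varepsilon)}_\nu\to S_\nu\qquad\text{and}\qquad \mathfrak M^{(\varepsilon)}_\nu\to\mathfrak L_\nu,$$ where convergence holds in the finite-dimensional space of elements of $\mathrm{Sym}_{\mathbb C}$ of degree $\le|\nu|$.
   Context: $\mathbb Y$ is the set of all partitions (Young diagrams); $|\nu|$ is the number of boxes and $\ell(\nu)$ the number of nonzero rows of $\nu$. For a box $\square=(i,j)$ (row $i$, column $j$), $c(\square)=j-i$; for $\mu\subseteq\nu$, $(z)_{\nu/\mu}=\prod_{\square\in\nu/\mu}(z+c(\square))$; $\dim\nu/\mu$ is the number of standard tableaux of skew shape $\nu/\mu$. $\mathrm{Sym}$ is the graded algebra of symmetric functions over $\mathbb R$, freely generated by the power sums $p_k$; $\mathrm{Sym}_{\mathbb C}$ is its complexification; $S_\nu$ are the Schur functions. Frobenius–Schur functions. Put $x^{\downarrow n}=x(x-1)\cdots(x-n+1)$. The factorial Schur polynomial is $S^{\mathsf f}_{\nu\mid N}(x_1,\dots,x_N)=\det[x_j^{\downarrow(\nu_i+N-i)}]_{i,j=1}^N/\prod_{i<j}(x_i-x_j)$ for $\ell(\nu)\le N$ (and $0$ if $\ell(\nu)>N$). The shifted Schur polynomial is $S^*_{\nu\mid N}(y_1,\dots,y_N)=S^{\mathsf f}_{\nu\mid N}(y_1+N-1,y_2+N-2,\dots,y_N)$; it satisfies $S^*_{\nu\mid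 N}|_{y_N=0}=S^*_{\nu\mid N-1}$. A polynomial in $y_1,\dots,y_N$ is shifted symmetric if it is symmetric in the variables $y_i+N-i$; $\mathrm{Sym}^*$ is the algebra of sequences $(f_N)_{N\ge1}$ of shifted symmetric polynomials in $N$ variables with $f_N|_{y_N=0}=f_{N-1}$ and $\sup_N\deg f_N<\infty$. Thus $S^*_\nu=(S^*_{\nu\mid N})_N\in\mathrm{Sym}^*$. The algebra $\mathrm{Sym}^*$ is freely generated by $p_k^*=\sum_{i\ge1}[(y_i-i+\frac12)^k-(-i+\frac12)^k]$, $k\ge1$, and $FS_\nu\in\mathrm{Sym}$ is the image of $S^*_\nu$ under the algebra isomorphism $\mathrm{Sym}^*\to\mathrm{Sym}$, $p^*_k\mapsto p_k$. Laguerre and Meixner symmetric functions: $$\mathfrak L_\nu=\sum_{\mu\subseteq\nu}(-1)^{|\nu|-|\mu|}\frac{\dim\nu/\mu}{(|\nu|-|\mu|)!}(z)_{\nu/\mu}(z')_{\nu/\mu}S_\mu,$$ $$\mathfrak M_\nu=\sum_{\mu\subseteq\nu}(-1)^{|\nu|-|\mu|}\left(\frac{\xi}{1-\xi}\right)^{|\nu|-|\mu|}\frac{\dim\nu/\mu}{(|\nu|-|\mu|)!}(z)_{\nu/\mu}(z')_{\nu/\mu}FS_\mu .$$ For $\varepsilon\in\mathbb C\setminus\{0\}$, $\varepsilon^{-G}$ is the operator acting on the $m$th homogeneous component as multiplication by $\varepsilon^{-m}$, $m=0,1,2,\dots$. Set $FS^{(\varepsilon)}_\nu=\varepsilon^{|\nu|}\varepsilon^{-G}FS_\nu$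 and $\mathfrak M^{(\varepsilon)}_\nu=\varepsilon^{|\nu|}\varepsilon^{-G}\mathfrak M_\nu$, where $\mathfrak M_\nu$ on the right has parameters $(z,z')$ and $\xi=1-\varepsilon$. *)

theory Defs
  imports
    Complex_Main
    "HOL-Library.Poly_Mapping"
    "HOL-Library.FuncSet"
    "Jordan_Normal_Form.Determinant"
begin

section \<open>Polynomials in variables indexed by the natural numbers\<close>

type_synonym 'a mpoly = "(nat \<Rightarrow>\<^sub>0 nat) \<Rightarrow>\<^sub>0 'a"

definition Const :: "'a::zero \<Rightarrow> 'a mpoly" where
  "Const c = Poly_Mapping.single 0 c"

definition Var :: "nat \<Rightarrow> 'a::comm_ring_1 mpoly" where
  "Var i = Poly_Mapping.single (Poly_Mapping.single i 1) 1"

definition subst :: "(nat \<Rightarrow> 'a::comm_ring_1 mpoly) \<Rightarrow> 'a mpoly \<Rightarrow> 'a mpoly" where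
  "subst a f = (\<Sum>m\<in>Poly_Mapping.keys f. Const (Poly_Mapping.lookup f m) *
     (\<Prod>i\<in>Poly_Mapping.keys m. a i ^ Poly_Mapping.lookup m i))"

text \<open>The quotient of \<open>a\<close> by a nonzero divisor \<open>b\<close>; it is unique because \<open>'a mpoly\<close> is an
  integral domain.\<close>

definition exact_quot :: "'a::idom mpoly \<Rightarrow> 'a mpoly \<Rightarrow> 'a mpoly" where
  "exact_quot a b = (THE q. q * b = a)"

section \<open>Partitions\<close>

text \<open>A partition is the function sending \<open>i\<close> to the length of row \<open>i + 1\<close>; rows and columns
  are counted from \<open>0\<close>. Contents \<open>j - i\<close> do not depend on this shift, and \<open>\<mu> \<subseteq> \<nu>\<close> is the
  pointwise order \<open>\<mu> \<le> \<nu>\<close>.\<close>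

definition young :: "(nat \<Rightarrow> nat) \<Rightarrow> bool" where
  "young \<nu> \<longleftrightarrow> antimono \<nu> \<and> finite {i. \<nu> i \<noteq> 0}"

definition psize :: "(nat \<Rightarrow> nat) \<Rightarrow> nat" where
  "psize \<nu> = (\<Sum>i | \<nu> i \<noteq> 0. \<nu> i)"

definition plength :: "(nat \<Rightarrow> nat) \<Rightarrow> nat" where
  "plength \<nu> = card {i. \<nu> i \<noteq> 0}"

definition skew :: "(nat \<Rightarrow> nat) \<Rightarrow> (nat \<Rightarrow> nat) \<Rightarrow> (nat \<times> nat) set" where
  "skew \<nu> \<mu> = {(i, j). \<mu> i \<le> j \<and> j < \<nu> i}"

definition content_prod :: "complex \<Rightarrow> (nat \<Rightarrow> nat) \<Rightarrow> (nat \<Rightarrow> nat) \<Rightarrow> complex" where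
  "content_prod z \<nu> \<mu> = (\<Prod>(i, j)\<in>skew \<nu> \<mu>. z + of_int (int j - int i))"

definition standard_tableaux :: "(nat \<times> nat) set \<Rightarrow> (nat \<times> nat \<Rightarrow> nat) set" where
  "standard_tableaux D = {T \<in> extensional D. bij_betw T D {1..card D} \<and>
     (\<forall>i j j'. (i, j) \<in> D \<and> (i, j') \<in> D \<and> j < j' \<longrightarrow> T (i, j) < T (i, j')) \<and>
     (\<forall>i i' j. (i, j) \<in> D \<and> (i', j) \<in> D \<and> i < i' \<longrightarrow> T (i, j) < T (i', j))}"

definition skew_dim :: "(nat \<Rightarrow> nat) \<Rightarrow> (nat \<Rightarrow> nat) \<Rightarrow> nat" where
  "skew_dim \<nu> \<mu> = card (standard_tableaux (skew \<nu> \<mu>))"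

section \<open>Schur, factorial Schur and shifted Schur polynomials\<close>

text \<open>In \<open>N\<close> variables, \<open>Var i\<close> for \<open>i < N\<close> stands for the variable usually numbered \<open>i + 1\<close>.\<close>

definition vandermonde :: "nat \<Rightarrow> real mpoly" where
  "vandermonde N = (\<Prod>j<N. \<Prod>i<j. Var i - Var j)"

definition schur_poly :: "(nat \<Rightarrow> nat) \<Rightarrow> nat \<Rightarrow> real mpoly" where
  "schur_poly \<nu> N = (if plength \<nu> \<le> N
     then exact_quot (det (mat N N (\<lambda>(i, j). Var j ^ (\<nu> i + (N - Suc i))))) (vandermonde N)
     else 0)"

definition falling :: "real mpoly \<Rightarrow> nat \<Rightarrow> real mpoly" where
  "falling x n = (\<Prod>k<n. x - of_nat k)"

definition factorial_schur_poly :: "(nat \<Rightarrow> nat) \<Rightarrow> nat \<Rightarrow> real mpoly" where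
  "factorial_schur_poly \<nu> N = (if plength \<nu> \<le> N
     then exact_quot (det (mat N N (\<lambda>(i, j). falling (Var j) (\<nu> i + (N - Suc i))))) (vandermonde N)
     else 0)"

definition shifted_schur_poly :: "(nat \<Rightarrow> nat) \<Rightarrow> nat \<Rightarrow> real mpoly" where
  "shifted_schur_poly \<nu> N =
     subst (\<lambda>i. Var i + of_nat (N - Suc i)) (factorial_schur_poly \<nu> N)"

section \<open>Symmetric functions\<close>

text \<open>\<open>Sym\<close> is freely generated by the power sums \<open>p\<^sub>1, p\<^sub>2, \<dots>\<close>, so it is represented as a
  polynomial ring over the reals, with \<open>Var k\<close> standing for \<open>p\<^sub>k\<^sub>+\<^sub>1\<close> (of degree \<open>k + 1\<close>).
  Its complexification has complex coefficients instead.\<close>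

type_synonym sym = "real mpoly"
type_synonym symC = "complex mpoly"

definition complexify :: "sym \<Rightarrow> symC" where
  "complexify = Poly_Mapping.map complex_of_real"

definition monom_degree :: "(nat \<Rightarrow>\<^sub>0 nat) \<Rightarrow> nat" where
  "monom_degree m = (\<Sum>k\<in>Poly_Mapping.keys m. Suc k * Poly_Mapping.lookup m k)"

definition power_sum :: "nat \<Rightarrow> nat \<Rightarrow> real mpoly" where
  "power_sum k N = (\<Sum>i<N. Var i ^ k)"

text \<open>The symmetric function \<open>f\<close> whose images in the rings of symmetric polynomials in
  \<open>N \<ge> 1\<close> variables are \<open>F N\<close>.\<close>

definition sym_of_seq :: "(nat \<Rightarrow> real mpoly) \<Rightarrow> sym" where
  "sym_of_seq F = (THE f. \<forall>N\<ge>1. subst (\<lambda>k. power_sum (Suc k) N) f = F N)"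

definition Schur :: "(nat \<Rightarrow> nat) \<Rightarrow> sym" where
  "Schur \<nu> = sym_of_seq (schur_poly \<nu>)"

text \<open>With \<open>i\<close> counted from \<open>0\<close>, the shift \<open>- i + 1/2\<close> becomes \<open>- i - 1/2\<close>.\<close>

definition p_star :: "nat \<Rightarrow> nat \<Rightarrow> real mpoly" where
  "p_star k N = (\<Sum>i<N. (Var i + Const (- real i - 1/2)) ^ k - Const (- real i - 1/2) ^ k)"

text \<open>The isomorphism from the algebra of shifted symmetric functions, whose elements are the
  stable sequences \<open>(F N)\<close>, \<open>N \<ge> 1\<close>, of shifted symmetric polynomials, to \<open>Sym\<close>: it is the
  inverse of the algebra homomorphism determined on the free generators by
  \<open>p\<^sub>k \<mapsto> (p_star k N)\<close>, \<open>N \<ge> 1\<close>.\<close>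

definition shifted_sym_iso :: "(nat \<Rightarrow> real mpoly) \<Rightarrow> sym" where
  "shifted_sym_iso F = (THE f. \<forall>N\<ge>1. subst (\<lambda>k. p_star (Suc k) N) f = F N)"

definition FS :: "(nat \<Rightarrow> nat) \<Rightarrow> sym" where
  "FS \<nu> = shifted_sym_iso (shifted_schur_poly \<nu>)"

section \<open>Laguerre and Meixner symmetric functions\<close>

definition Laguerre :: "complex \<Rightarrow> complex \<Rightarrow> (nat \<Rightarrow> nat) \<Rightarrow> symC" where
  "Laguerre z z' \<nu> = (\<Sum>\<mu> | young \<mu> \<and> \<mu> \<le> \<nu>.
     Const ((-1) ^ (psize \<nu> - psize \<mu>) *
       (of_nat (skew_dim \<nu> \<mu>) / fact (psize \<nu> - psize \<mu>)) *
       content_prod z \<nu> \<mu> * content_prod z' \<nu> \<mu>) * complexify (Schur \<mu>))"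

definition Meixner :: "complex \<Rightarrow> complex \<Rightarrow> complex \<Rightarrow> (nat \<Rightarrow> nat) \<Rightarrow> symC" where
  "Meixner z z' \<xi> \<nu> = (\<Sum>\<mu> | young \<mu> \<and> \<mu> \<le> \<nu>.
     Const ((-1) ^ (psize \<nu> - psize \<mu>) * (\<xi> / (1 - \<xi>)) ^ (psize \<nu> - psize \<mu>) *
       (of_nat (skew_dim \<nu> \<mu>) / fact (psize \<nu> - psize \<mu>)) *
       content_prod z \<nu> \<mu> * content_prod z' \<nu> \<mu>) * complexify (FS \<mu>))"

text \<open>The operator multiplying the homogeneous component of degree \<open>m\<close> by \<open>\<epsilon>\<^sup>-\<^sup>m\<close>.\<close>

definition eps_neg_G :: "complex \<Rightarrow> symC \<Rightarrow> symC" where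
  "eps_neg_G \<epsilon> f = Poly_Mapping.mapp (\<lambda>m c. inverse \<epsilon> ^ monom_degree m * c) f"

definition FS_eps :: "complex \<Rightarrow> (nat \<Rightarrow> nat) \<Rightarrow> symC" where
  "FS_eps \<epsilon> \<nu> = Const (\<epsilon> ^ psize \<nu>) * eps_neg_G \<epsilon> (complexify (FS \<nu>))"

definition Meixner_eps :: "complex \<Rightarrow> complex \<Rightarrow> complex \<Rightarrow> (nat \<Rightarrow> nat) \<Rightarrow> symC" where
  "Meixner_eps z z' \<epsilon> \<nu> = Const (\<epsilon> ^ psize \<nu>) * eps_neg_G \<epsilon> (Meixner z z' (1 - \<epsilon>) \<nu>)"

section \<open>Convergence\<close>

definition SymC_le :: "nat \<Rightarrow> symC set" where
  "SymC_le n = {f. \<forall>m\<in>Poly_Mapping.keys f. monom_degree m \<le> n}"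

text \<open>Convergence as \<open>\<epsilon> \<rightarrow> 0\<close>, \<open>\<epsilon> \<noteq> 0\<close>, inside the finite-dimensional space \<open>SymC_le n\<close>,
  i.e. convergence of coordinates in the basis of monomials in the power sums.\<close>

definition converges_in_SymC_le :: "nat \<Rightarrow> (complex \<Rightarrow> symC) \<Rightarrow> symC \<Rightarrow> bool" where
  "converges_in_SymC_le n f l \<longleftrightarrow>
     (\<forall>\<epsilon>. \<epsilon> \<noteq> 0 \<longrightarrow> f \<epsilon> \<in> SymC_le n) \<and> l \<in> SymC_le n \<and>
     (\<forall>m. ((\<lambda>\<epsilon>. Poly_Mapping.lookup (f \<epsilon>) m) \<longlongrightarrow> Poly_Mapping.lookup l m) (at 0))"

end

theory Submission
  imports Defs
begin

text \<open>
  Everything rests on one fact: the Frobenius-Schur function of \<open>\<nu>\<close> has degree at most \<open>|\<nu>|\<close>, and its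
  homogeneous component of degree \<open>|\<nu>|\<close> is the Schur function (\<open>lead_FS\<close>). The rescaling by \<open>\<epsilon>\<close>
  multiplies the component of degree \<open>m\<close> by \<open>\<epsilon>\<close> to the power \<open>|\<nu>| - m\<close>, so only the top component
  survives in the limit. The rescaled Meixner function is the combination of the rescaled
  Frobenius-Schur functions whose coefficients are those of the Laguerre function times powers of
  \<open>1 - \<epsilon>\<close>, and the limit is taken term by term.

  Leading forms are compared in \<open>N\<close> variables. The falling factorial \<open>x (x - 1) \<cdots> (x - n + 1)\<close> has
  leading form \<open>x\<^sup>n\<close>; dividing by the Vandermonde product, the factorial Schur polynomial has leading
  form the Schur polynomial (\<open>lead_factorial_schur\<close>), and the shift of variables does not change it.
  The generator \<open>p\<^sub>k\<^sup>*\<close> in \<open>N\<close> variables has leading form \<open>p\<^sub>k\<close> (\<open>lead_p_star\<close>). Since leading forms are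
  compatible with substitution (\<open>lead_subst\<close>), the claim follows from the algebraic independence of
  the power sums (\<open>power_sums_independent\<close>), once it is known that the Frobenius-Schur function exists
  and is unique. Uniqueness is again independence of the power sums, transferred to the \<open>p\<^sub>k\<^sup>*\<close> through
  leading forms (\<open>p_star_independent\<close>).

  For existence (\<open>FS_exists\<close>), the quotient defining the factorial Schur polynomial exists by Newton
  interpolation (\<open>det_alternant\<close>), is symmetric, and is therefore a polynomial in the power sums
  (\<open>symmetric_in_power_sums\<close>), which yields an expression of the shifted Schur polynomial through the
  \<open>p\<^sub>k\<^sup>*\<close> for \<open>|\<nu>| + 1\<close> variables. By stability (\<open>shifted_schur_stable\<close>) it is also valid for fewer
  variables, and for more variables by a divisibility argument (\<open>symmetric_vanishing\<close>).
\<close>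

section \<open>Evaluation of polynomials\<close>

text \<open>The value of \<open>f\<close> at the point \<open>v\<close>, the coefficients being mapped by \<open>\<phi>\<close> into the target
  ring. Substitution is the case \<open>\<phi> = Const\<close>, so that one proof of multiplicativity covers
  substitutions and evaluations at points.\<close>

definition mpoly_eval :: "('a::comm_ring_1 \<Rightarrow> 'b::comm_ring_1) \<Rightarrow> (nat \<Rightarrow> 'b) \<Rightarrow> 'a mpoly \<Rightarrow> 'b" where
  "mpoly_eval \<phi> v f = (\<Sum>m\<in>Poly_Mapping.keys f. \<phi> (Poly_Mapping.lookup f m) *
     (\<Prod>i\<in>Poly_Mapping.keys m. v i ^ Poly_Mapping.lookup m i))"

lemma subst_eq_mpoly_eval: "subst a = mpoly_eval Const a"
  by (rule ext) (simp add: subst_def mpoly_eval_def)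

lemma lookup_Const_mult [simp]:
  "Poly_Mapping.lookup (Const c * f) m = c * Poly_Mapping.lookup (f :: 'a::comm_ring_1 mpoly) m"
  unfolding Const_def mult_map_scale_conv_mult[symmetric]
  by (simp add: Poly_Mapping.map.rep_eq when_def)

lemma Const_hom: "comm_ring_hom (Const :: 'a::comm_ring_1 \<Rightarrow> 'a mpoly)"
  by unfold_locales
    (auto simp: Const_def mult_single single_add simp flip: single_one)

lemma sum_single_lookup:
  "(\<Sum>m\<in>Poly_Mapping.keys f. Poly_Mapping.single m (Poly_Mapping.lookup f m)) = f"
  by (rule poly_mapping_eqI)
    (auto simp: lookup_sum lookup_single when_def in_keys_iff)

lemma prod_keys_superset:
  fixes v :: "nat \<Rightarrow> 'b::comm_monoid_mult"
  assumes "finite S" "Poly_Mapping.keys m \<subseteq> S"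
  shows "(\<Prod>i\<in>Poly_Mapping.keys m. v i ^ Poly_Mapping.lookup m i) =
    (\<Prod>i\<in>S. v i ^ Poly_Mapping.lookup m i)"
  by (rule prod.mono_neutral_left) (use assms in \<open>auto simp: in_keys_iff\<close>)

lemma prod_keys_add:
  fixes v :: "nat \<Rightarrow> 'b::comm_monoid_mult"
  shows "(\<Prod>i\<in>Poly_Mapping.keys (m + m'). v i ^ Poly_Mapping.lookup (m + m') i) =
    (\<Prod>i\<in>Poly_Mapping.keys m. v i ^ Poly_Mapping.lookup m i) *
    (\<Prod>i\<in>Poly_Mapping.keys m'. v i ^ Poly_Mapping.lookup m' i)"
proof -
  let ?S = "Poly_Mapping.keys m \<union> Poly_Mapping.keys m'"
  have S: "finite ?S" "Poly_Mapping.keys (m + m') \<subseteq> ?S"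
    using keys_add[of m m'] by simp_all
  show ?thesis
    unfolding prod_keys_superset[OF S] prod_keys_superset[OF S(1) Un_upper1]
      prod_keys_superset[OF S(1) Un_upper2]
    by (simp add: lookup_add power_add prod.distrib)
qed

context
  fixes \<phi> :: "'a::comm_ring_1 \<Rightarrow> 'b::comm_ring_1" and v :: "nat \<Rightarrow> 'b"
  assumes \<phi>: "comm_ring_hom \<phi>"
begin

interpretation comm_ring_hom \<phi> by (rule \<phi>)

lemma mpoly_eval_superset:
  assumes "finite S" "Poly_Mapping.keys f \<subseteq> S"
  shows "mpoly_eval \<phi> v f = (\<Sum>m\<in>S. \<phi> (Poly_Mapping.lookup f m) *
     (\<Prod>i\<in>Poly_Mapping.keys m. v i ^ Poly_Mapping.lookup m i))"
  unfolding mpoly_eval_def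
  by (rule sum.mono_neutral_left) (use assms in \<open>auto simp: in_keys_iff\<close>)

lemma mpoly_eval_single:
  "mpoly_eval \<phi> v (Poly_Mapping.single m c) =
    \<phi> c * (\<Prod>i\<in>Poly_Mapping.keys m. v i ^ Poly_Mapping.lookup m i)"
  by (subst mpoly_eval_superset[of "{m}"]) (auto split: if_splits)

lemma mpoly_eval_add: "mpoly_eval \<phi> v (f + g) = mpoly_eval \<phi> v f + mpoly_eval \<phi> v g"
proof -
  let ?S = "Poly_Mapping.keys f \<union> Poly_Mapping.keys g"
  have "Poly_Mapping.keys (f + g) \<subseteq> ?S"
    by (rule keys_add)
  then show ?thesis
    by (simp add: mpoly_eval_superset[of ?S] lookup_add hom_add distrib_right sum.distrib)
qed

lemma mpoly_eval_sum: "mpoly_eval \<phi> v (sum F A) = (\<Sum>x\<in>A. mpoly_eval \<phi> v (F x))"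
  by (induction A rule: infinite_finite_induct) (simp_all add: mpoly_eval_add, simp_all add: mpoly_eval_def)

lemma mpoly_eval_mult: "mpoly_eval \<phi> v (f * g) = mpoly_eval \<phi> v f * mpoly_eval \<phi> v g"
proof -
  have "mpoly_eval \<phi> v (f * g) = mpoly_eval \<phi> v
     ((\<Sum>m\<in>Poly_Mapping.keys f. Poly_Mapping.single m (Poly_Mapping.lookup f m)) *
      (\<Sum>m\<in>Poly_Mapping.keys g. Poly_Mapping.single m (Poly_Mapping.lookup g m)))"
    by (simp only: sum_single_lookup)
  also have "\<dots> = (\<Sum>m\<in>Poly_Mapping.keys f. \<Sum>m'\<in>Poly_Mapping.keys g.
      mpoly_eval \<phi> v (Poly_Mapping.single m (Poly_Mapping.lookup f m)) *
      mpoly_eval \<phi> v (Poly_Mapping.single m' (Poly_Mapping.lookup g m')))"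
    by (simp add: sum_product mpoly_eval_sum mult_single mpoly_eval_single prod_keys_add hom_mult
        mult_ac)
  also have "\<dots> = mpoly_eval \<phi> v f * mpoly_eval \<phi> v g"
    by (simp add: sum_product mpoly_eval_def[of _ _ f] mpoly_eval_def[of _ _ g] mpoly_eval_single)
  finally show ?thesis .
qed

lemma mpoly_eval_Const [simp]: "mpoly_eval \<phi> v (Const c) = \<phi> c"
  by (simp add: Const_def mpoly_eval_single)

lemma mpoly_eval_Var [simp]: "mpoly_eval \<phi> v (Var i) = v i"
  by (simp add: Var_def mpoly_eval_single)

lemma mpoly_eval_hom: "comm_ring_hom (mpoly_eval \<phi> v)"
proof
  show "mpoly_eval \<phi> v 1 = 1"
    using mpoly_eval_single[of 0 1] by simp
qed (simp_all add: mpoly_eval_add mpoly_eval_mult mpoly_eval_def[of _ _ 0])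

end

lemma subst_hom: "comm_ring_hom (subst a)"
  unfolding subst_eq_mpoly_eval by (rule mpoly_eval_hom[OF Const_hom])

interpretation Const_hom: comm_ring_hom "Const :: 'a::comm_ring_1 \<Rightarrow> 'a mpoly"
  by (rule Const_hom)

interpretation subst_hom: comm_ring_hom "subst a :: 'a::comm_ring_1 mpoly \<Rightarrow> 'a mpoly" for a
  by (rule subst_hom)

lemma subst_Const [simp]: "subst a (Const c) = Const c"
  by (simp add: subst_eq_mpoly_eval Const_hom)

lemma subst_Var [simp]: "subst a (Var i) = a i"
  by (simp add: subst_eq_mpoly_eval Const_hom)

lemma subst_cong:
  assumes "\<And>i. (\<exists>m\<in>Poly_Mapping.keys f. i \<in> Poly_Mapping.keys m) \<Longrightarrow> a i = b i"
  shows "subst a f = subst b f"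
proof -
  have "a i = b i" if "m \<in> Poly_Mapping.keys f" "i \<in> Poly_Mapping.keys m" for m i
    using assms that by blast
  then show ?thesis
    unfolding subst_def
    by (intro sum.cong refl arg_cong2[of _ _ _ _ "(*)"] prod.cong) simp_all
qed

lemma mpoly_eval_subst:
  assumes "comm_ring_hom \<phi>"
  shows "mpoly_eval \<phi> v (subst a f) = mpoly_eval \<phi> (\<lambda>i. mpoly_eval \<phi> v (a i)) f"
proof -
  interpret e: comm_ring_hom "mpoly_eval \<phi> v"
    by (rule mpoly_eval_hom[OF assms])
  show ?thesis
    by (simp add: subst_def mpoly_eval_def[of _ _ f] e.hom_sum e.hom_mult e.hom_prod e.hom_power assms)
qed

lemma subst_subst: "subst a (subst b f) = subst (\<lambda>i. subst a (b i)) f"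
  using mpoly_eval_subst[OF Const_hom] unfolding subst_eq_mpoly_eval by blast

lemma subst_Var_id [simp]: "subst Var f = f"
proof -
  have "(\<Prod>i\<in>Poly_Mapping.keys m. Var i ^ Poly_Mapping.lookup m i) = Poly_Mapping.single m (1::'a)" for m
  proof -
    have pw: "Var i ^ k = Poly_Mapping.single (Poly_Mapping.single i k) (1::'a)" for i k
      by (induction k) (auto simp: Var_def mult_single simp flip: single_add)
    have "finite S \<Longrightarrow> (\<Prod>i\<in>S. Poly_Mapping.single (Poly_Mapping.single i (Poly_Mapping.lookup m i)) (1::'a)) =
      Poly_Mapping.single (\<Sum>i\<in>S. Poly_Mapping.single i (Poly_Mapping.lookup m i)) 1" for S
      by (induction S rule: finite_induct) (auto simp: mult_single)
    then show ?thesis by (simp add: pw sum_single_lookup)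
  qed
  then show ?thesis
    by (simp add: subst_def Const_def mult_single sum_single_lookup)
qed

lemma prod_Var_keys:
  "(\<Prod>i\<in>Poly_Mapping.keys m. Var i ^ Poly_Mapping.lookup m i) = Poly_Mapping.single m (1::'a::comm_ring_1)"
  using subst_Var_id[of "Poly_Mapping.single m (1::'a)"]
  by (simp add: subst_eq_mpoly_eval mpoly_eval_single[OF Const_hom])

text \<open>Setting the variables outside \<open>A\<close> to zero keeps exactly the monomials in the variables
  from \<open>A\<close>.\<close>

lemma lookup_subst_restrict:
  "Poly_Mapping.lookup (subst (\<lambda>i. if i \<in> A then Var i else 0) f) m =
    (if Poly_Mapping.keys m \<subseteq> A then Poly_Mapping.lookup f m else 0)"
proof -
  have "(\<Prod>i\<in>Poly_Mapping.keys m'. (if i \<in> A then Var i else 0) ^ Poly_Mapping.lookup m' i) =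
    Poly_Mapping.single m' (if Poly_Mapping.keys m' \<subseteq> A then 1 else (0::'a))" for m'
  proof (cases "Poly_Mapping.keys m' \<subseteq> A")
    case True
    then have "(\<Prod>i\<in>Poly_Mapping.keys m'. (if i \<in> A then Var i else 0) ^ Poly_Mapping.lookup m' i) =
      (\<Prod>i\<in>Poly_Mapping.keys m'. Var i ^ Poly_Mapping.lookup m' i :: 'a mpoly)"
      by (intro prod.cong) auto
    then show ?thesis using True by (simp add: prod_Var_keys)
  next
    case False
    then obtain i where "i \<in> Poly_Mapping.keys m'" "i \<notin> A" by blast
    then have "(\<Prod>i\<in>Poly_Mapping.keys m'. (if i \<in> A then Var i else 0) ^ Poly_Mapping.lookup m' i) = (0 :: 'a mpoly)"
      by (intro prod_zero) (auto intro!: bexI[of _ i] simp: in_keys_iff power_0_left)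
    then show ?thesis using False by simp
  qed
  then have "Poly_Mapping.lookup (subst (\<lambda>i. if i \<in> A then Var i else 0) f) m =
    (\<Sum>m'\<in>Poly_Mapping.keys f. if m' = m then
       Poly_Mapping.lookup f m * (if Poly_Mapping.keys m \<subseteq> A then 1 else 0) else 0)"
    unfolding subst_def lookup_sum by (intro sum.cong) (auto simp: lookup_single when_def)
  then show ?thesis
    by (simp add: in_keys_iff)
qed

section \<open>Weighted degrees and leading forms\<close>

text \<open>The degree of a monomial when the \<open>k\<close>-th variable has weight \<open>w k\<close>. Weight \<open>1\<close> is the usual
  degree in the variables \<open>x\<close> or \<open>y\<close>; weight \<open>Suc\<close> is the grading of the symmetric functions.\<close>

definition mdeg :: "(nat \<Rightarrow> nat) \<Rightarrow> (nat \<Rightarrow>\<^sub>0 nat) \<Rightarrow> nat" where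
  "mdeg w m = (\<Sum>k\<in>Poly_Mapping.keys m. w k * Poly_Mapping.lookup m k)"

lemma mdeg_superset:
  assumes "finite S" "Poly_Mapping.keys m \<subseteq> S"
  shows "mdeg w m = (\<Sum>k\<in>S. w k * Poly_Mapping.lookup m k)"
  unfolding mdeg_def
  by (rule sum.mono_neutral_left) (use assms in \<open>auto simp: in_keys_iff\<close>)

lemma mdeg_add: "mdeg w (m + m') = mdeg w m + mdeg w m'"
proof -
  let ?S = "Poly_Mapping.keys m \<union> Poly_Mapping.keys m'"
  have "Poly_Mapping.keys (m + m') \<subseteq> ?S"
    by (rule keys_add)
  then show ?thesis
    by (simp add: mdeg_superset[of ?S] lookup_add distrib_left sum.distrib)
qed

lemma mdeg_0 [simp]: "mdeg w 0 = 0"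
  by (simp add: mdeg_def)

text \<open>The polynomials of weighted degree less than \<open>d\<close>; degree at most \<open>d\<close> is
  \<open>deg_below w (Suc d)\<close>.\<close>

definition deg_below :: "(nat \<Rightarrow> nat) \<Rightarrow> nat \<Rightarrow> 'a::comm_ring_1 mpoly set" where
  "deg_below w d = {f. \<forall>m\<in>Poly_Mapping.keys f. mdeg w m < d}"

lemma deg_below_mono: "f \<in> deg_below w d \<Longrightarrow> d \<le> e \<Longrightarrow> f \<in> deg_below w e"
  by (force simp: deg_below_def)

lemma deg_below_0 [simp]: "0 \<in> deg_below w d"
  by (simp add: deg_below_def)

lemma deg_below_add: "f \<in> deg_below w d \<Longrightarrow> g \<in> deg_below w d \<Longrightarrow> f + g \<in> deg_below w d"
  using keys_add[of f g] by (auto simp: deg_below_def)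

lemma deg_below_minus: "f \<in> deg_below w d \<Longrightarrow> - f \<in> deg_below w d"
  by (auto simp: deg_below_def in_keys_iff)

lemma deg_below_diff: "f \<in> deg_below w d \<Longrightarrow> g \<in> deg_below w d \<Longrightarrow> f - g \<in> deg_below w d"
  using deg_below_add[of f w d "- g"] deg_below_minus[of g w d] by simp

lemma deg_below_sum: "(\<And>x. x \<in> A \<Longrightarrow> F x \<in> deg_below w d) \<Longrightarrow> sum F A \<in> deg_below w d"
  by (induction A rule: infinite_finite_induct) (auto intro: deg_below_add)

lemma deg_below_mult:
  "f \<in> deg_below w d \<Longrightarrow> g \<in> deg_below w (Suc e) \<Longrightarrow> f * g \<in> deg_below w (d + e)"
  using keys_mult[of f g] by (fastforce simp: deg_below_def mdeg_add)

lemma deg_below_Const: "Const c \<in> deg_below w (Suc d)"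
  by (auto simp: deg_below_def Const_def)

lemma deg_below_ex: "\<exists>d. f \<in> deg_below w d"
proof (intro exI)
  show "f \<in> deg_below w (Suc (\<Sum>m\<in>Poly_Mapping.keys f. mdeg w m))"
    by (auto simp: deg_below_def less_Suc_eq_le intro: member_le_sum)
qed

text \<open>\<open>g\<close> is the homogeneous component of degree \<open>d\<close> of \<open>f\<close>, which has degree at most \<open>d\<close>.
  The component \<open>g\<close> may be zero.\<close>

definition lead :: "(nat \<Rightarrow> nat) \<Rightarrow> nat \<Rightarrow> 'a::comm_ring_1 mpoly \<Rightarrow> 'a mpoly \<Rightarrow> bool" where
  "lead w d f g \<longleftrightarrow> (\<forall>m\<in>Poly_Mapping.keys g. mdeg w m = d) \<and> f - g \<in> deg_below w d"

lemma lead_deg_below: "lead w d f g \<Longrightarrow> f \<in> deg_below w (Suc d)"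
  using deg_below_add[of "f - g" w "Suc d" g] deg_below_mono[of "f - g" w d "Suc d"]
  by (auto simp: lead_def) (auto simp: deg_below_def)

lemma lead_lookup:
  assumes "lead w d f g"
  shows "Poly_Mapping.lookup g m = (if mdeg w m = d then Poly_Mapping.lookup f m else 0)"
proof (cases "mdeg w m = d")
  case True
  then have "m \<notin> Poly_Mapping.keys (f - g)"
    using assms by (auto simp: lead_def deg_below_def)
  then show ?thesis using True by (simp add: in_keys_iff lookup_minus)
next
  case False
  then show ?thesis using assms by (auto simp: lead_def in_keys_iff)
qed

lemma lead_unique: "lead w d f g \<Longrightarrow> lead w d f g' \<Longrightarrow> g = g'"
  by (rule poly_mapping_eqI) (simp add: lead_lookup)

lemma lead_0_iff: "lead w d f 0 \<longleftrightarrow> f \<in> deg_below w d"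
  by (simp add: lead_def)

lemma lead_homogeneous: "lead w d f g \<Longrightarrow> lead w d g g"
  by (simp add: lead_def)

text \<open>The homogeneous component of degree \<open>d\<close>.\<close>

definition hcomp :: "(nat \<Rightarrow> nat) \<Rightarrow> nat \<Rightarrow> 'a::comm_ring_1 mpoly \<Rightarrow> 'a mpoly" where
  "hcomp w d f = Poly_Mapping.mapp (\<lambda>m c. if mdeg w m = d then c else 0) f"

lemma lookup_hcomp:
  "Poly_Mapping.lookup (hcomp w d f) m = (if mdeg w m = d then Poly_Mapping.lookup f m else 0)"
  by (auto simp: hcomp_def lookup_mapp when_def in_keys_iff)

lemma lead_hcomp: "f \<in> deg_below w (Suc d) \<Longrightarrow> lead w d f (hcomp w d f)"
  by (fastforce simp: lead_def deg_below_def in_keys_iff lookup_hcomp lookup_minus less_Suc_eq split: if_splits)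

text \<open>For the degree to be less than \<open>n\<close> it suffices that \<open>f\<close>, if of degree at most \<open>d \<ge> n\<close>, has no
  component of degree exactly \<open>d\<close>.\<close>

lemma deg_below_descent:
  assumes "\<And>d. n \<le> d \<Longrightarrow> f \<in> deg_below w (Suc d) \<Longrightarrow> hcomp w d f = 0"
  shows "f \<in> deg_below w n"
proof -
  obtain D where D: "f \<in> deg_below w D" using deg_below_ex by blast
  have "f \<in> deg_below w (D - k) \<or> f \<in> deg_below w n" for k
  proof (induction k)
    case 0
    then show ?case using D by simp
  next
    case (Suc k)
    show ?case
    proof (cases "n < D - k \<and> f \<in> deg_below w (D - k)")
      case True
      then have e: "D - k = Suc (D - Suc k)" by linarith
      with True have "f \<in> deg_below w (Suc (D - Suc k))" "n \<le> D - Suc k" by (simp_all add: e)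
      then have "lead w (D - Suc k) f 0"
        using assms[of "D - Suc k"] lead_hcomp[of f w "D - Suc k"] by simp
      then show ?thesis by (simp add: lead_0_iff)
    next
      case False
      then show ?thesis using Suc deg_below_mono[of f w "D - k" n] by (auto simp: not_less)
    qed
  qed
  from this[of D] show ?thesis using deg_below_mono[of f w 0 n] by auto
qed

lemma lead_add: "lead w d f g \<Longrightarrow> lead w d f' g' \<Longrightarrow> lead w d (f + f') (g + g')"
  using keys_add[of g g'] deg_below_add[of "f - g" w d "f' - g'"]
  by (auto simp: lead_def algebra_simps)

lemma lead_sum: "(\<And>x. x \<in> A \<Longrightarrow> lead w d (F x) (G x)) \<Longrightarrow> lead w d (sum F A) (sum G A)"
  by (induction A rule: infinite_finite_induct) (simp_all add: lead_add, simp_all add: lead_0_iff)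

lemma lead_mult:
  assumes "lead w d f g" "lead w e f' g'"
  shows "lead w (d + e) (f * f') (g * g')"
proof -
  have "\<forall>m\<in>Poly_Mapping.keys (g * g'). mdeg w m = d + e"
    using assms keys_mult[of g g'] by (fastforce simp: lead_def mdeg_add)
  moreover have "(f - g) * f' \<in> deg_below w (d + e)"
    using assms lead_deg_below[OF assms(2)] by (intro deg_below_mult) (auto simp: lead_def)
  moreover have "(f' - g') * g \<in> deg_below w (e + d)"
    using assms lead_deg_below[OF lead_homogeneous[OF assms(1)]]
    by (intro deg_below_mult) (auto simp: lead_def)
  moreover have "f * f' - g * g' = (f - g) * f' + (f' - g') * g"
    by (simp add: algebra_simps)
  ultimately show ?thesis
    by (auto simp: lead_def add.commute intro: deg_below_add)
qed

lemma lead_Const: "lead w 0 (Const c) (Const c)"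
  by (auto simp: lead_def Const_def)

lemma lead_1: "lead w 0 1 1"
  using lead_Const[of w 1] by simp

lemma lead_Const_mult: "lead w d f g \<Longrightarrow> lead w d (Const c * f) (Const c * g)"
  using lead_mult[OF lead_Const] by force

lemma lead_minus: "lead w d f g \<Longrightarrow> lead w d (- f) (- g)"
  using lead_Const_mult[of w d f g "-1"] by (simp add: Const_hom.hom_uminus)

lemma lead_prod:
  "(\<And>x. x \<in> A \<Longrightarrow> lead w (d x) (F x) (G x)) \<Longrightarrow> lead w (sum d A) (prod F A) (prod G A)"
  by (induction A rule: infinite_finite_induct) (auto intro: lead_mult simp: lead_1)

lemma lead_power: "lead w d f g \<Longrightarrow> lead w (d * k) (f ^ k) (g ^ k)"
  using lead_prod[of "{..<k}" w "\<lambda>_. d" "\<lambda>_. f" "\<lambda>_. g"] by (simp add: mult.commute)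

lemma lead_Var: "lead w (w i) (Var i) (Var i)"
  by (auto simp: lead_def Var_def mdeg_def)

lemma lead_add_lower: "lead w d f g \<Longrightarrow> h \<in> deg_below w d \<Longrightarrow> lead w d (f + h) g"
  using lead_add[of w d f g h 0] by (simp add: lead_0_iff)

text \<open>If the substituted polynomials have degrees matching the weights, the leading form of a
  substitution is obtained by substituting leading forms into the leading form.\<close>

lemma lead_subst:
  assumes "lead w d f g" "\<And>k. lead w' (w k) (a k) (b k)"
  shows "lead w' d (subst a f) (subst b g)"
proof -
  have mon: "lead w' (mdeg w m) (\<Prod>i\<in>Poly_Mapping.keys m. a i ^ Poly_Mapping.lookup m i)
      (\<Prod>i\<in>Poly_Mapping.keys m. b i ^ Poly_Mapping.lookup m i)" for m
    unfolding mdeg_def by (intro lead_prod lead_power assms)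
  have "lead w' d (subst a g) (subst b g)"
    unfolding subst_def
  proof (intro lead_sum lead_Const_mult)
    fix m assume "m \<in> Poly_Mapping.keys g"
    then have "mdeg w m = d" using assms(1) by (simp add: lead_def)
    then show "lead w' d (\<Prod>i\<in>Poly_Mapping.keys m. a i ^ Poly_Mapping.lookup m i)
      (\<Prod>i\<in>Poly_Mapping.keys m. b i ^ Poly_Mapping.lookup m i)" using mon by force
  qed
  moreover have "subst a (f - g) \<in> deg_below w' d"
    unfolding subst_def
  proof (rule deg_below_sum)
    fix m assume "m \<in> Poly_Mapping.keys (f - g)"
    then have "mdeg w m < d" using assms(1) by (simp add: lead_def deg_below_def)
    moreover have "Const c * (\<Prod>i\<in>Poly_Mapping.keys m. a i ^ Poly_Mapping.lookup m i)
       \<in> deg_below w' (Suc (mdeg w m))" for c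
      by (rule lead_deg_below[OF lead_Const_mult[OF mon]])
    ultimately show "Const (Poly_Mapping.lookup (f - g) m) *
       (\<Prod>i\<in>Poly_Mapping.keys m. a i ^ Poly_Mapping.lookup m i) \<in> deg_below w' d"
      by (meson deg_below_mono Suc_leI)
  qed
  ultimately show ?thesis
    using lead_add_lower[of w' d "subst a g" "subst b g" "subst a (f - g)"]
    by (simp add: subst_hom.hom_minus)
qed

lemma deg_below_subst:
  assumes "f \<in> deg_below w (Suc d)" "\<And>k. a k \<in> deg_below w' (Suc (w k))"
  shows "subst a f \<in> deg_below w' (Suc d)"
  by (rule lead_deg_below, rule lead_subst[OF lead_hcomp[OF assms(1)] lead_hcomp[OF assms(2)]])

section \<open>Alternants and the Vandermonde product\<close>

text \<open>The coefficients of \<open>(t - c\<^sub>0) \<cdots> (t - c\<^sub>a\<^sub>-\<^sub>1)\<close> in the Newton basis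
  \<open>(t - x\<^sub>0) \<cdots> (t - x\<^sub>k\<^sub>-\<^sub>1)\<close>.\<close>

fun newton_coeff :: "(nat \<Rightarrow> 'a::comm_ring_1) \<Rightarrow> (nat \<Rightarrow> 'a) \<Rightarrow> nat \<Rightarrow> nat \<Rightarrow> 'a" where
  "newton_coeff c x 0 k = (if k = 0 then 1 else 0)"
| "newton_coeff c x (Suc a) k = (x k - c a) * newton_coeff c x a k +
     (case k of 0 \<Rightarrow> 0 | Suc k' \<Rightarrow> newton_coeff c x a k')"

lemma newton_coeff_gt: "a < k \<Longrightarrow> newton_coeff c x a k = 0"
  by (induction a arbitrary: k) (auto split: nat.split)

lemma newton_coeff_diag [simp]: "newton_coeff c x a a = 1"
  by (induction a) (auto simp: newton_coeff_gt)

lemma newton_expansion: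
  "(\<Prod>m<a. t - c m) = (\<Sum>k\<le>a. newton_coeff c x a k * (\<Prod>l<k. t - x l))"
proof (induction a)
  case (Suc a)
  let ?n = "newton_coeff c x a" and ?P = "\<lambda>k. \<Prod>l<k. t - x l"
  have "(\<Prod>m<Suc a. t - c m) = (\<Sum>k\<le>a. (x k - c a) * ?n k * ?P k + ?n k * ?P (Suc k))"
    unfolding prod.lessThan_Suc Suc.IH sum_distrib_right
    by (intro sum.cong refl) (simp add: algebra_simps)
  also have "\<dots> = (\<Sum>k\<le>a. (x k - c a) * ?n k * ?P k) + (\<Sum>k\<le>a. ?n k * ?P (Suc k))"
    by (rule sum.distrib)
  also have "(\<Sum>k\<le>a. (x k - c a) * ?n k * ?P k) = (\<Sum>k\<le>Suc a. (x k - c a) * ?n k * ?P k)"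
    by (simp add: newton_coeff_gt)
  also have "(\<Sum>k\<le>a. ?n k * ?P (Suc k)) =
     (\<Sum>k\<le>Suc a. (case k of 0 \<Rightarrow> 0 | Suc k' \<Rightarrow> ?n k') * ?P k)"
    by (subst sum.atMost_Suc_shift) simp
  finally show ?case
    by (simp add: distrib_right sum.distrib)
qed simp

lemma newton_expansion_node:
  assumes "j < N"
  shows "(\<Prod>m<a. x j - c m) = (\<Sum>k<N. newton_coeff c x a k * (\<Prod>l<k. x j - x l))"
proof -
  let ?f = "\<lambda>k. newton_coeff c x a k * (\<Prod>l<k. x j - x l)"
  have z: "(\<Prod>l<k. x j - x l) = 0" if "\<not> k < N" for k
    by (rule prod_zero) (use assms that in \<open>auto intro!: bexI[of _ j]\<close>)
  have "sum ?f {..a} = sum ?f ({..a} \<union> {..<N})"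
    by (rule sum.mono_neutral_left) (auto simp: newton_coeff_gt)
  also have "\<dots> = sum ?f {..<N}"
    by (rule sum.mono_neutral_right) (auto simp: z)
  finally show ?thesis
    by (simp add: newton_expansion[where c = c and x = x])
qed

text \<open>The Vandermonde product at arbitrary ring elements.\<close>

definition vdm :: "(nat \<Rightarrow> 'a::comm_ring_1) \<Rightarrow> nat \<Rightarrow> 'a" where
  "vdm x N = (\<Prod>j<N. \<Prod>i<j. x i - x j)"

lemma vandermonde_eq_vdm: "vandermonde = vdm Var"
  by (rule ext) (simp add: vandermonde_def vdm_def)

text \<open>The unit \<open>(-1)\<close> to the number of pairs \<open>i < j < N\<close>.\<close>

definition rev_sign :: "nat \<Rightarrow> 'a::comm_ring_1" where
  "rev_sign N = (\<Prod>j<N. \<Prod>i<j. - 1)"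

lemma rev_sign_square: "rev_sign N * rev_sign N = 1"
  by (simp add: rev_sign_def flip: prod.distrib)

text \<open>Newton interpolation factors the matrix with entries \<open>(x\<^sub>j - c\<^sub>0) \<cdots> (x\<^sub>j - c\<^sub>m\<^sub>-\<^sub>1)\<close>,
  \<open>m = \<alpha> i\<close>, into the matrix of Newton coefficients and a triangular one.\<close>

lemma det_alternant:
  "det (mat N N (\<lambda>(i, j). \<Prod>m<\<alpha> i. x j - c m)) =
    det (mat N N (\<lambda>(i, k). newton_coeff c x (\<alpha> i) k)) * (rev_sign N * vdm x N)"
proof -
  let ?C = "mat N N (\<lambda>(i, k). newton_coeff c x (\<alpha> i) k)"
  let ?T = "mat N N (\<lambda>(k, j). \<Prod>l<k. x j - x l)"
  have "mat N N (\<lambda>(i, j). \<Prod>m<\<alpha> i. x j - c m) = ?C * ?T"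
  proof (rule eq_matI)
    fix i j assume "i < dim_row (?C * ?T)" "j < dim_col (?C * ?T)"
    then have "i < N" "j < N" by simp_all
    then show "mat N N (\<lambda>(i, j). \<Prod>m<\<alpha> i. x j - c m) $$ (i, j) = (?C * ?T) $$ (i, j)"
      using newton_expansion_node[where j = j and N = N and a = "\<alpha> i" and x = x and c = c]
      by (simp add: scalar_prod_def atLeast0LessThan)
  qed auto
  moreover have "det (?C * ?T) = det ?C * det ?T"
    by (rule det_mult) auto
  moreover have "det ?T = prod_list (diag_mat ?T)"
    by (rule det_upper_triangular[where n = N])
      (auto simp: upper_triangular_def intro!: prod_zero)
  moreover have "prod_list (diag_mat ?T) = (\<Prod>j<N. \<Prod>l<j. x j - x l)"
    by (simp add: prod_list_diag_prod atLeast0LessThan)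
  moreover have "(\<Prod>j<N. \<Prod>l<j. x j - x l) = rev_sign N * vdm x N"
    unfolding rev_sign_def vdm_def prod.distrib[symmetric] by simp
  ultimately show ?thesis by simp
qed

lemma det_vandermonde:
  "det (mat N N (\<lambda>(i, j). x j ^ i)) = rev_sign N * vdm x N"
proof -
  have "det (mat N N (\<lambda>(i, k). newton_coeff (\<lambda>_. 0) x i k)) = 1"
    by (subst det_lower_triangular[where n = N]) (auto simp: newton_coeff_gt prod_list_diag_prod)
  then show ?thesis
    using det_alternant[where \<alpha> = "\<lambda>i. i" and c = "\<lambda>_. 0" and x = x and N = N] by simp
qed

lemma det_permute_columns:
  assumes "\<sigma> permutes {..<N}"
  shows "det (mat N N (\<lambda>(i, j). g i (\<sigma> j))) = signof \<sigma> * det (mat N N (\<lambda>(i, j). g i j))"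
proof -
  let ?A = "mat N N (\<lambda>(j, i). g i j)"
  have "det (mat N N (\<lambda>(i, j). g i (\<sigma> j))) = det (transpose_mat (mat N N (\<lambda>(i, j). g i (\<sigma> j))))"
    by (rule det_transpose[symmetric, where n = N]) simp
  also have "transpose_mat (mat N N (\<lambda>(i, j). g i (\<sigma> j))) = mat N N (\<lambda>(i, j). ?A $$ (\<sigma> i, j))"
    using permutes_in_image[OF assms] by (intro eq_matI) auto
  also have "det \<dots> = signof \<sigma> * det ?A"
    using assms by (intro det_permute_rows) (auto simp: atLeast0LessThan)
  also have "det ?A = det (transpose_mat ?A)"
    by (rule det_transpose[symmetric, where n = N]) simp
  also have "transpose_mat ?A = mat N N (\<lambda>(i, j). g i j)"
    by (intro eq_matI) auto
  finally show ?thesis .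
qed

lemma det_scale_columns:
  "det (mat N N (\<lambda>(i, j). c j * g i j)) = (\<Prod>j<N. c j) * det (mat N N (\<lambda>(i, j). g i j))"
proof -
  have "signof p * (\<Prod>i<N. c (p i) * g i (p i)) = (\<Prod>j<N. c j) * (signof p * (\<Prod>i<N. g i (p i)))"
    if "p permutes {..<N}" for p
  proof -
    have "(\<Prod>i<N. c (p i)) = (\<Prod>j<N. c j)"
      using prod.permute[OF that, of c] by (simp add: o_def)
    then show ?thesis by (simp add: prod.distrib mult_ac)
  qed
  moreover have "det (mat N N (\<lambda>(i, j). h i j)) =
      (\<Sum>p | p permutes {..<N}. signof p * (\<Prod>i<N. h i (p i)))" for h :: "nat \<Rightarrow> nat \<Rightarrow> 'a"
  proof -
    have "(\<Prod>i<N. mat N N (\<lambda>(i, j). h i j) $$ (i, p i)) = (\<Prod>i<N. h i (p i))"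
      if "p permutes {..<N}" for p
      using permutes_in_image[OF that] by (intro prod.cong) auto
    then show ?thesis
      by (subst det_def'[where n = N]) (auto simp: atLeast0LessThan intro!: sum.cong)
  qed
  ultimately show ?thesis
    by (simp add: sum_distrib_left)
qed

lemma vdm_permute:
  assumes "\<sigma> permutes {..<N}"
  shows "vdm (\<lambda>i. x (\<sigma> i)) N = signof \<sigma> * vdm x N"
proof -
  have "rev_sign N * vdm (\<lambda>i. x (\<sigma> i)) N = signof \<sigma> * (rev_sign N * vdm x N)"
    using det_permute_columns[OF assms, of "\<lambda>i j. x j ^ i"] by (simp add: det_vandermonde)
  then have "rev_sign N * rev_sign N * vdm (\<lambda>i. x (\<sigma> i)) N =
      rev_sign N * rev_sign N * (signof \<sigma> * vdm x N)"
    by (simp add: mult_ac)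
  then show ?thesis by (simp add: rev_sign_square)
qed

lemma Var_neq [simp]: "Var i = (Var j :: 'a::comm_ring_1 mpoly) \<longleftrightarrow> i = j"
proof
  assume "Var i = (Var j :: 'a mpoly)"
  then have "subst (\<lambda>k. if k = i then 1 else 0) (Var i :: 'a mpoly) =
      subst (\<lambda>k. if k = i then 1 else 0) (Var j)" by simp
  then show "i = j" by (auto split: if_splits)
qed simp

lemma vandermonde_nonzero: "vandermonde N \<noteq> 0"
  by (auto simp: vandermonde_def)

lemma subst_vdm: "subst a (vdm x N) = vdm (\<lambda>i. subst a (x i)) N"
  by (simp add: vdm_def subst_hom.hom_prod subst_hom.hom_minus)

section \<open>Factorial Schur polynomials\<close>

lemma subst_falling: "subst a (falling x n) = falling (subst a x) n"
  by (simp add: falling_def subst_hom.hom_prod subst_hom.hom_minus subst_hom.hom_of_nat)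

text \<open>The numerator of the factorial Schur polynomial at arbitrary points.\<close>

definition fdet :: "(nat \<Rightarrow> real mpoly) \<Rightarrow> nat \<Rightarrow> (nat \<Rightarrow> nat) \<Rightarrow> real mpoly" where
  "fdet x N \<nu> = det (mat N N (\<lambda>(i, j). falling (x j) (\<nu> i + (N - Suc i))))"

lemma subst_fdet: "subst a (fdet x N \<nu>) = fdet (\<lambda>i. subst a (x i)) N \<nu>"
proof -
  have "map_mat (subst a) (mat N N (\<lambda>(i, j). falling (x j) (\<nu> i + (N - Suc i)))) =
    mat N N (\<lambda>(i, j). falling (subst a (x j)) (\<nu> i + (N - Suc i)))"
    by (rule eq_matI) (auto simp: subst_falling)
  then show ?thesis
    unfolding fdet_def subst_hom.hom_det[symmetric] by simp
qed

lemma fdet_cong: "(\<And>i. i < N \<Longrightarrow> x i = y i) \<Longrightarrow> fdet x N \<nu> = fdet y N \<nu>"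
  unfolding fdet_def by (intro arg_cong[of _ _ det] eq_matI) auto

lemma vdm_cong: "(\<And>i. i < N \<Longrightarrow> x i = y i) \<Longrightarrow> vdm x N = vdm y N"
  unfolding vdm_def by (intro prod.cong) auto

lemma factorial_schur_mult_vandermonde:
  assumes "plength \<nu> \<le> N"
  shows "factorial_schur_poly \<nu> N * vandermonde N = fdet Var N \<nu>"
proof -
  let ?q = "det (mat N N (\<lambda>(i, k). newton_coeff of_nat Var (\<nu> i + (N - Suc i)) k)) * rev_sign N"
  have q: "?q * vandermonde N = fdet Var N \<nu>"
    unfolding fdet_def falling_def vandermonde_eq_vdm
    by (subst det_alternant) (simp add: mult_ac)
  have "(THE q. q * vandermonde N = fdet Var N \<nu>) * vandermonde N = fdet Var N \<nu>"
  proof (rule theI)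
    fix q assume "q * vandermonde N = fdet Var N \<nu>"
    then have "q * vandermonde N = ?q * vandermonde N" by (simp only: q)
    then show "q = ?q" by (simp only: mult_right_cancel[OF vandermonde_nonzero])
  qed (rule q)
  then show ?thesis
    using assms by (simp add: factorial_schur_poly_def exact_quot_def fdet_def)
qed

text \<open>Numerator and Vandermonde product both change by the sign of \<open>\<sigma>\<close>, and the nonzero Vandermonde
  product can be cancelled. The same cancellation shows that no other variables occur.\<close>

lemma factorial_schur_symmetric:
  assumes \<sigma>: "\<sigma> permutes {..<N}"
  shows "subst (\<lambda>i. Var (\<sigma> i)) (factorial_schur_poly \<nu> N) = factorial_schur_poly \<nu> N"
proof (cases "plength \<nu> \<le> N")
  case True
  let ?Q = "factorial_schur_poly \<nu> N" and ?h = "subst (\<lambda>i. Var (\<sigma> i)) :: real mpoly \<Rightarrow> _"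
  have "?h ?Q * (signof \<sigma> * vandermonde N) = ?h (?Q * vandermonde N)"
    using vdm_permute[OF \<sigma>, of "Var :: nat \<Rightarrow> real mpoly"]
    by (simp add: subst_hom.hom_mult vandermonde_eq_vdm subst_vdm)
  also have "\<dots> = signof \<sigma> * fdet Var N \<nu>"
    unfolding factorial_schur_mult_vandermonde[OF True] subst_fdet
    using det_permute_columns[OF \<sigma>, of "\<lambda>i j. falling (Var j) (\<nu> i + (N - Suc i))"]
    by (simp add: fdet_def)
  also have "\<dots> = ?Q * (signof \<sigma> * vandermonde N)"
    by (simp add: factorial_schur_mult_vandermonde[OF True, symmetric])
  finally show ?thesis
    using vandermonde_nonzero[of N] by (simp add: sign_def split: if_splits)
qed (simp add: factorial_schur_poly_def)

lemma factorial_schur_vars: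
  "subst (\<lambda>i. if i \<in> {..<N} then Var i else 0) (factorial_schur_poly \<nu> N) = factorial_schur_poly \<nu> N"
proof (cases "plength \<nu> \<le> N")
  case True
  let ?Q = "factorial_schur_poly \<nu> N"
  let ?h = "subst (\<lambda>i. if i \<in> {..<N} then Var i else 0) :: real mpoly \<Rightarrow> _"
  have "?h ?Q * vandermonde N = ?h (?Q * vandermonde N)"
    by (simp add: subst_hom.hom_mult vandermonde_eq_vdm subst_vdm cong: vdm_cong)
  also have "\<dots> = ?Q * vandermonde N"
    unfolding factorial_schur_mult_vandermonde[OF True] by (simp add: subst_fdet cong: fdet_cong)
  finally show ?thesis
    using vandermonde_nonzero[of N] by simp
qed (simp add: factorial_schur_poly_def)

text \<open>If \<open>V\<close> is homogeneous and nonzero, the leading form of a quotient by \<open>V\<close> is the quotient of the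
  leading forms.\<close>

lemma lead_quotient:
  fixes q V :: "'a::idom mpoly"
  assumes "lead w (n + e) (q * V) B" "lead w e V V" "V \<noteq> 0"
  shows "lead w n q (hcomp w n q)" "hcomp w n q * V = B"
proof -
  have "q \<in> deg_below w (Suc n)"
  proof (rule deg_below_descent)
    fix d assume d: "Suc n \<le> d" "q \<in> deg_below w (Suc d)"
    then have "lead w (d + e) (q * V) (hcomp w d q * V)"
      by (intro lead_mult lead_hcomp assms)
    moreover have "lead w (d + e) (q * V) 0"
      using d lead_deg_below[OF assms(1)] by (auto simp: lead_0_iff intro: deg_below_mono)
    ultimately show "hcomp w d q = 0"
      using assms(3) lead_unique by fastforce
  qed
  then show *: "lead w n q (hcomp w n q)"
    by (rule lead_hcomp)
  from lead_unique[OF lead_mult[OF * assms(2)] assms(1)] show "hcomp w n q * V = B" .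
qed

lemma lead_Var_plus_Const: "lead (\<lambda>_. 1) 1 (Var i + Const c) (Var i)"
  using lead_add_lower[OF lead_Var[of "\<lambda>_. 1" i], of "Const c"] deg_below_Const[of c "\<lambda>_. 1" 0] by simp

lemma lead_falling: "lead (\<lambda>_. 1) n (falling (Var j) n) (Var j ^ n)"
proof -
  have "lead (\<lambda>_. 1) 1 (Var j - of_nat k :: real mpoly) (Var j)" for k
    using lead_Var_plus_Const[of j "- of_nat k"]
    by (simp add: Const_hom.hom_uminus Const_hom.hom_of_nat)
  then have "lead (\<lambda>_. 1) (\<Sum>k<n. 1) (falling (Var j) n) (\<Prod>k<n. Var j)"
    unfolding falling_def by (intro lead_prod)
  then show ?thesis by simp
qed

lemma lead_vandermonde: "lead (\<lambda>_. 1) (\<Sum>j<N. j) (vandermonde N) (vandermonde N)"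
proof -
  have "lead (\<lambda>_. 1) 1 (Var i - Var j :: real mpoly) (Var i - Var j)" for i j
    using lead_add[OF lead_Var lead_minus[OF lead_Var], of "\<lambda>_. 1" i j] by simp
  then have "lead (\<lambda>_. 1) (\<Sum>j<N. \<Sum>i<j. 1) (vandermonde N) (vandermonde N)"
    unfolding vandermonde_def by (intro lead_prod)
  then show ?thesis by simp
qed

lemma lead_det:
  fixes f g :: "nat \<Rightarrow> nat \<Rightarrow> 'a::comm_ring_1 mpoly"
  assumes "\<And>i j. i < N \<Longrightarrow> j < N \<Longrightarrow> lead w (\<alpha> i) (f i j) (g i j)"
  shows "lead w (\<Sum>i<N. \<alpha> i) (det (mat N N (\<lambda>(i, j). f i j))) (det (mat N N (\<lambda>(i, j). g i j)))"
proof -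
  have "lead w (\<Sum>i<N. \<alpha> i)
    (signof p * (\<Prod>i<N. mat N N (\<lambda>(i, j). f i j) $$ (i, p i)))
    (signof p * (\<Prod>i<N. mat N N (\<lambda>(i, j). g i j) $$ (i, p i)))"
    if "p permutes {..<N}" for p
  proof -
    have "lead w (\<Sum>i<N. \<alpha> i) (\<Prod>i<N. mat N N (\<lambda>(i, j). f i j) $$ (i, p i))
      (\<Prod>i<N. mat N N (\<lambda>(i, j). g i j) $$ (i, p i))"
      using permutes_in_image[OF that] by (intro lead_prod) (auto intro!: assms)
    from lead_Const_mult[OF this, of "signof p"] show ?thesis
      by (simp only: Const_hom.hom_signof)
  qed
  then show ?thesis
    by (subst (1 2) det_def'[where n = N]) (auto simp: atLeast0LessThan intro!: lead_sum)
qed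

lemma young_support:
  assumes "young \<nu>"
  shows "{i. \<nu> i \<noteq> 0} = {..<plength \<nu>}"
proof -
  let ?S = "{i. \<nu> i \<noteq> 0}"
  have fin: "finite ?S" and anti: "antimono \<nu>" using assms by (auto simp: young_def)
  have down: "j \<in> ?S" if "i \<in> ?S" "j \<le> i" for i j
    using that antimonoD[OF anti, of j i] by simp
  have "?S = {..<card ?S}"
  proof (cases "?S = {}")
    case False
    have "?S = {..Max ?S}"
      using Max_ge[OF fin] down[OF Max_in[OF fin False]] by blast
    then have "?S = {..<Suc (Max ?S)}"
      by (simp only: lessThan_Suc_atMost)
    moreover from this have "card ?S = Suc (Max ?S)"
      by (metis card_lessThan)
    ultimately show ?thesis by simp
  qed simp
  then show ?thesis by (simp add: plength_def)
qed

lemma young_eq_0_iff: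
  assumes "young \<nu>"
  shows "\<nu> i = 0 \<longleftrightarrow> plength \<nu> \<le> i"
proof -
  have "i \<in> {i. \<nu> i \<noteq> 0} \<longleftrightarrow> i \<in> {..<plength \<nu>}"
    by (simp only: young_support[OF assms])
  then show ?thesis by (cases "\<nu> i = 0") simp_all
qed

lemma psize_eq_sum:
  assumes "young \<nu>" "plength \<nu> \<le> N"
  shows "psize \<nu> = (\<Sum>i<N. \<nu> i)"
  unfolding psize_def using assms(2)
  by (intro sum.mono_neutral_left) (auto simp: young_eq_0_iff[OF assms(1)])

text \<open>The Schur polynomial is the component of top degree of the factorial one.\<close>

lemma lead_factorial_schur:
  assumes "young \<nu>"
  shows "lead (\<lambda>_. 1) (psize \<nu>) (factorial_schur_poly \<nu> N) (schur_poly \<nu> N)"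
proof (cases "plength \<nu> \<le> N")
  case True
  let ?B = "det (mat N N (\<lambda>(i, j). Var j ^ (\<nu> i + (N - Suc i)))) :: real mpoly"
  let ?Q = "factorial_schur_poly \<nu> N"
  have "(\<Sum>i<N. N - Suc i) = (\<Sum>j<N. j)"
    by (rule sum.nat_diff_reindex)
  then have deg: "(\<Sum>i<N. \<nu> i + (N - Suc i)) = psize \<nu> + (\<Sum>j<N. j)"
    unfolding sum.distrib psize_eq_sum[OF assms True] by simp
  have "lead (\<lambda>_. 1) (psize \<nu> + (\<Sum>j<N. j)) (?Q * vandermonde N) ?B"
    unfolding factorial_schur_mult_vandermonde[OF True] fdet_def deg[symmetric]
    by (rule lead_det) (rule lead_falling)
  note q = lead_quotient[OF this lead_vandermonde vandermonde_nonzero]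
  have "(THE q. q * vandermonde N = ?B) = hcomp (\<lambda>_. 1) (psize \<nu>) ?Q"
  proof (rule the_equality)
    fix q assume "q * vandermonde N = ?B"
    then have "q * vandermonde N = hcomp (\<lambda>_. 1) (psize \<nu>) ?Q * vandermonde N"
      by (simp only: q(2))
    then show "q = hcomp (\<lambda>_. 1) (psize \<nu>) ?Q"
      by (simp only: mult_right_cancel[OF vandermonde_nonzero])
  qed (rule q(2))
  then show ?thesis
    using True q(1) by (simp add: schur_poly_def exact_quot_def)
qed (simp add: factorial_schur_poly_def schur_poly_def lead_def)

section \<open>Shifted Schur polynomials\<close>

text \<open>The change of variables \<open>x\<^sub>i = y\<^sub>i + N - i\<close> (with \<open>i\<close> counted from \<open>1\<close>) between the variables \<open>y\<close>
  of shifted symmetric polynomials and the variables \<open>x\<close> of symmetric ones, and its inverse.\<close>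

definition shift_up :: "nat \<Rightarrow> nat \<Rightarrow> real mpoly" where
  "shift_up N i = Var i + of_nat (N - Suc i)"

definition shift_down :: "nat \<Rightarrow> nat \<Rightarrow> real mpoly" where
  "shift_down N i = Var i - of_nat (N - Suc i)"

lemma shifted_schur_poly_eq: "shifted_schur_poly \<nu> N = subst (shift_up N) (factorial_schur_poly \<nu> N)"
  by (simp add: shifted_schur_poly_def shift_up_def[abs_def])

lemma subst_shift_down_up [simp]: "subst (shift_down N) (subst (shift_up N) f) = f"
  by (simp add: subst_subst shift_up_def shift_down_def subst_hom.hom_add subst_hom.hom_of_nat)

lemma subst_shift_up_down [simp]: "subst (shift_up N) (subst (shift_down N) f) = f"
  by (simp add: subst_subst shift_up_def shift_down_def subst_hom.hom_minus subst_hom.hom_of_nat)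

lemma subst_shift_up_eq_0: "subst (shift_up N) f = 0 \<longleftrightarrow> f = 0"
  by (metis subst_shift_down_up subst_hom.hom_zero)

lemma falling_0: "falling 0 n = (if n = 0 then 1 else 0)"
  by (cases n) (auto simp: falling_def prod.lessThan_Suc_shift simp del: prod.lessThan_Suc)

lemma falling_Suc: "falling x (Suc n) = x * falling (x - 1) n"
  by (simp add: falling_def prod.lessThan_Suc_shift diff_diff_eq del: prod.lessThan_Suc)

text \<open>When the last point is \<open>0\<close>, the last column of the numerator vanishes except possibly in the
  corner, and in the remaining minor the factor \<open>x\<^sub>j\<close> splits off from the \<open>j\<close>-th column.\<close>

lemma fdet_last_zero:
  assumes "x N = 0"
  shows "fdet x (Suc N) \<nu> = (if \<nu> N = 0 then (\<Prod>j<N. x j) * fdet (\<lambda>j. x j - 1) N \<nu> else 0)"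
proof -
  let ?A = "mat (Suc N) (Suc N) (\<lambda>(i, j). falling (x j) (\<nu> i + (Suc N - Suc i)))"
  have "fdet x (Suc N) \<nu> = (\<Sum>i<Suc N. ?A $$ (i, N) * cofactor ?A i N)"
    unfolding fdet_def by (rule laplace_expansion_column[where n = "Suc N"]) auto
  also have "\<dots> = ?A $$ (N, N) * cofactor ?A N N"
    by (simp add: assms falling_0)
  also have "?A $$ (N, N) = (if \<nu> N = 0 then 1 else 0)"
    by (simp add: assms falling_0)
  also have "cofactor ?A N N = det (mat_delete ?A N N)"
    by (simp add: cofactor_def flip: mult_2)
  also have "mat_delete ?A N N = mat N N (\<lambda>(i, j). x j * falling (x j - 1) (\<nu> i + (N - Suc i)))"
    unfolding mat_delete_def
  proof (rule eq_matI)
    fix i j assume "i < dim_row (mat N N (\<lambda>(i, j). x j * falling (x j - 1) (\<nu> i + (N - Suc i))))"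
      "j < dim_col (mat N N (\<lambda>(i, j). x j * falling (x j - 1) (\<nu> i + (N - Suc i))))"
    moreover from this have "N - i = Suc (N - Suc i)" by simp
    ultimately show "mat (dim_row ?A - 1) (dim_col ?A - 1)
      (\<lambda>(i, j). ?A $$ (if i < N then i else Suc i, if j < N then j else Suc j)) $$ (i, j) =
      mat N N (\<lambda>(i, j). x j * falling (x j - 1) (\<nu> i + (N - Suc i))) $$ (i, j)"
      by (simp add: falling_Suc)
  qed auto
  also have "det \<dots> = (\<Prod>j<N. x j) * fdet (\<lambda>j. x j - 1) N \<nu>"
    unfolding fdet_def by (rule det_scale_columns)
  finally show ?thesis by simp
qed

text \<open>Setting the last of \<open>N + 1\<close> variables \<open>y\<close> to zero turns the points \<open>x\<^sub>i\<close> into those for \<open>N\<close>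
  variables shifted by one, together with \<open>0\<close>. The extra factors \<open>x\<^sub>j - 0\<close> of the Vandermonde product
  cancel those of the numerator.\<close>

lemma shifted_schur_stable:
  assumes "young \<nu>"
  shows "subst (\<lambda>i. if i = N then 0 else Var i) (shifted_schur_poly \<nu> (Suc N)) = shifted_schur_poly \<nu> N"
proof (cases "plength \<nu> \<le> Suc N")
  case True
  let ?z = "\<lambda>i. if i = N then 0 else Var i :: real mpoly"
  define b where "b = (\<lambda>i. subst ?z (shift_up (Suc N) i))"
  let ?L = "subst ?z (shifted_schur_poly \<nu> (Suc N))"
  have bN: "b N = 0"
    by (simp add: b_def shift_up_def subst_hom.hom_add)
  have b: "b i = shift_up N i + 1" if "i < N" for i
  proof -
    have "N - i = Suc (N - Suc i)" using that by simp
    then show ?thesis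
      using that by (simp add: b_def shift_up_def subst_hom.hom_add subst_hom.hom_of_nat)
  qed
  have bnz: "b i \<noteq> 0" if "i < N" for i
  proof
    assume "b i = 0"
    then have "Var i = Const (- of_nat (N - Suc i) - 1 :: real)"
      using b[OF that] by (simp add: shift_up_def Const_hom.hom_minus Const_hom.hom_uminus
        Const_hom.hom_of_nat algebra_simps eq_neg_iff_add_eq_0)
    then have "subst (\<lambda>_. 0) (Var i) = subst (\<lambda>_. 0) (Const (- of_nat (N - Suc i) - 1 :: real))"
      by simp
    moreover have "- of_nat (N - Suc i) - 1 \<noteq> (0::real)" by simp
    ultimately show False
      unfolding subst_Const subst_Var by (metis Const_def single_zero single_eq_single lookup_single_eq lookup_zero)
  qed
  have vb: "vdm b (Suc N) = (\<Prod>j<N. b j) * vdm (shift_up N) N"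
  proof -
    have "vdm b N = vdm (shift_up N) N"
      unfolding vdm_def by (intro prod.cong) (auto simp: b)
    then show ?thesis by (simp add: vdm_def bN)
  qed
  have nz: "(\<Prod>j<N. b j) * vdm (shift_up N) N \<noteq> 0"
    using bnz vandermonde_nonzero[of N] subst_shift_up_eq_0[of N "vandermonde N"]
    by (auto simp: vandermonde_eq_vdm subst_vdm)
  have "?L * vdm b (Suc N) = subst b (factorial_schur_poly \<nu> (Suc N) * vandermonde (Suc N))"
    by (simp add: shifted_schur_poly_eq subst_subst subst_hom.hom_mult vandermonde_eq_vdm subst_vdm
        b_def[symmetric])
  also have "\<dots> = fdet b (Suc N) \<nu>"
    unfolding factorial_schur_mult_vandermonde[OF True] by (simp add: subst_fdet)
  also have "\<dots> = shifted_schur_poly \<nu> N * vdm b (Suc N)"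
  proof (cases "plength \<nu> \<le> N")
    case True
    then have "\<nu> N = 0" using young_eq_0_iff[OF assms] by simp
    then have "fdet b (Suc N) \<nu> = (\<Prod>j<N. b j) * fdet (\<lambda>j. b j - 1) N \<nu>"
      by (simp add: fdet_last_zero[where x = b and N = N, OF bN])
    also have "fdet (\<lambda>j. b j - 1) N \<nu> = fdet (shift_up N) N \<nu>"
      by (rule fdet_cong) (simp add: b)
    also have "\<dots> = subst (shift_up N) (factorial_schur_poly \<nu> N * vandermonde N)"
      unfolding factorial_schur_mult_vandermonde[OF True] by (simp add: subst_fdet)
    also have "\<dots> = shifted_schur_poly \<nu> N * vdm (shift_up N) N"
      by (simp add: shifted_schur_poly_eq subst_hom.hom_mult vandermonde_eq_vdm subst_vdm)
    finally show ?thesis by (simp add: vb mult_ac)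
  next
    case False
    then have "\<nu> N \<noteq> 0" using young_eq_0_iff[OF assms] by simp
    then have "fdet b (Suc N) \<nu> = 0" by (simp add: fdet_last_zero[where x = b and N = N, OF bN])
    then show ?thesis
      using False by (simp add: shifted_schur_poly_def factorial_schur_poly_def)
  qed
  finally show ?thesis
    using nz by (simp add: vb)
qed (simp add: shifted_schur_poly_def factorial_schur_poly_def)

section \<open>Algebraic independence of the power sums\<close>

lemma id_hom: "comm_ring_hom (\<lambda>x :: 'a::comm_ring_1. x)"
  by unfold_locales auto

lemma monomial_scale:
  fixes v :: "nat \<Rightarrow> 'a::comm_ring_1"
  shows "(\<Prod>i\<in>Poly_Mapping.keys m. (v(k := 2 * v k)) i ^ Poly_Mapping.lookup m i) =
    2 ^ Poly_Mapping.lookup m k * (\<Prod>i\<in>Poly_Mapping.keys m. v i ^ Poly_Mapping.lookup m i)"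
proof -
  let ?S = "insert k (Poly_Mapping.keys m)"
  have S: "finite ?S" "Poly_Mapping.keys m \<subseteq> ?S" by auto
  have "(\<Prod>i\<in>?S. (v(k := 2 * v k)) i ^ Poly_Mapping.lookup m i) =
    (\<Prod>i\<in>?S. (if i = k then 2 ^ Poly_Mapping.lookup m k else 1) * v i ^ Poly_Mapping.lookup m i)"
    by (rule prod.cong) (auto simp: power_mult_distrib)
  then show ?thesis
    unfolding prod_keys_superset[OF S] prod.distrib by simp
qed

text \<open>Distinct monomials are linearly independent as functions. As for distinct characters, doubling
  one coordinate and subtracting a multiple of the original relation eliminates one monomial.\<close>

lemma monomials_independent:
  fixes c :: "(nat \<Rightarrow>\<^sub>0 nat) \<Rightarrow> real"
  assumes "finite S"
    and "\<And>v. (\<Sum>m\<in>S. c m * (\<Prod>i\<in>Poly_Mapping.keys m. v i ^ Poly_Mapping.lookup m i)) = 0"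
  shows "\<forall>m\<in>S. c m = 0"
  using assms
proof (induction S arbitrary: c rule: finite_induct)
  case (insert m' S)
  define M :: "(nat \<Rightarrow> real) \<Rightarrow> (nat \<Rightarrow>\<^sub>0 nat) \<Rightarrow> real" where
    "M = (\<lambda>v m. \<Prod>i\<in>Poly_Mapping.keys m. v i ^ Poly_Mapping.lookup m i)"
  have eq: "c m' * M v m' + (\<Sum>m\<in>S. c m * M v m) = 0" for v
    using insert.prems[of v] insert.hyps by (simp add: M_def)
  have S0: "\<forall>m\<in>S. c m = 0"
  proof
    fix m assume m: "m \<in> S"
    then have "m \<noteq> m'" using insert.hyps by auto
    then obtain k where k: "Poly_Mapping.lookup m k \<noteq> Poly_Mapping.lookup m' k"
      by (meson poly_mapping_eqI)
    have scale: "M (v(k := 2 * v k)) n = 2 ^ Poly_Mapping.lookup n k * M v n" for v n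
      unfolding M_def by (rule monomial_scale)
    have "(\<Sum>m\<in>S. (c m * (2 ^ Poly_Mapping.lookup m k - 2 ^ Poly_Mapping.lookup m' k)) * M v m) = 0" for v
    proof -
      have "(\<Sum>m\<in>S. (c m * (2 ^ Poly_Mapping.lookup m k - 2 ^ Poly_Mapping.lookup m' k)) * M v m) =
        (\<Sum>m\<in>S. c m * M (v(k := 2 * v k)) m) - 2 ^ Poly_Mapping.lookup m' k * (\<Sum>m\<in>S. c m * M v m)"
        unfolding scale sum_distrib_left sum_subtractf[symmetric]
        by (intro sum.cong refl) (simp add: algebra_simps)
      also have "\<dots> = (c m' * M (v(k := 2 * v k)) m' + (\<Sum>m\<in>S. c m * M (v(k := 2 * v k)) m)) -
          2 ^ Poly_Mapping.lookup m' k * (c m' * M v m' + (\<Sum>m\<in>S. c m * M v m))"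
        unfolding scale[of v m'] by (simp add: algebra_simps)
      also have "\<dots> = 0" unfolding eq by simp
      finally show ?thesis .
    qed
    from insert.IH[OF this[unfolded M_def]] m
    have "c m * (2 ^ Poly_Mapping.lookup m k - 2 ^ Poly_Mapping.lookup m' k) = 0"
      by (rule bspec)
    then show "c m = 0" using k by simp
  qed
  moreover have "c m' = 0"
    using eq[of "\<lambda>_. 1"] S0 by (simp add: M_def)
  ultimately show ?case by simp
qed simp

lemma mpoly_eq_0I:
  fixes f :: "real mpoly"
  assumes "\<And>v. mpoly_eval (\<lambda>x. x) v f = 0"
  shows "f = 0"
proof -
  have "\<forall>m\<in>Poly_Mapping.keys f. Poly_Mapping.lookup f m = 0"
    by (rule monomials_independent) (use assms in \<open>auto simp: mpoly_eval_def\<close>)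
  then show ?thesis
    by (intro poly_mapping_eqI) (auto simp: in_keys_iff)
qed

text \<open>The list of points repeats \<open>i + 1\<close> with multiplicity \<open>\<mu> i\<close>.\<close>

lemma points_with_multiplicities:
  "\<exists>xs. \<forall>k. (\<Sum>x\<leftarrow>xs. x ^ Suc k) = (\<Sum>i<K. real (\<mu> i) * real (Suc i) ^ Suc k)"
proof (induction K)
  case (Suc K)
  then obtain xs where xs: "\<And>k. (\<Sum>x\<leftarrow>xs. x ^ Suc k) = (\<Sum>i<K. real (\<mu> i) * real (Suc i) ^ Suc k)"
    by blast
  show ?case
    by (intro exI[of _ "xs @ replicate (\<mu> K) (real (Suc K))"] allI, subst map_append, subst sum_list_append, subst xs)
      (simp add: sum_list_replicate)
qed (auto intro: exI[of _ "[]"])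

lemma polynomial_zero_if_zero_on_nat:
  fixes P :: "real poly"
  assumes "\<And>n::nat. poly P (real n) = 0"
  shows "P = 0"
proof (rule ccontr)
  assume "P \<noteq> 0"
  then have "finite {x. poly P x = 0}" by (rule poly_roots_finite)
  moreover have "range real \<subseteq> {x. poly P x = 0}" using assms by auto
  ultimately have "finite (range real)" by (rule rev_finite_subset)
  then have "finite (UNIV :: nat set)"
    by (rule finite_imageD) (simp add: inj_on_def)
  then show False by simp
qed

lemma vandermonde_solve:
  fixes v :: "nat \<Rightarrow> real"
  shows "\<exists>r. \<forall>k<K. (\<Sum>i<K. r i * real (Suc i) ^ Suc k) = v k"
proof -
  let ?A = "mat K K (\<lambda>(k, i). real (Suc i) ^ k)"
  have A: "?A \<in> carrier_mat K K" by simp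
  have "det ?A = rev_sign K * vdm (\<lambda>i. real (Suc i)) K"
    by (rule det_vandermonde)
  then have "det ?A \<noteq> 0"
    by (auto simp: rev_sign_def vdm_def)
  from det_non_zero_imp_unit[OF A this, where b = "()"]
  obtain B where B: "B \<in> carrier_mat K K" "?A * B = 1\<^sub>m K"
    unfolding Units_def ring_mat_def by auto
  let ?s = "B *\<^sub>v vec K v"
  have s: "?A *\<^sub>v ?s = vec K v"
    using assoc_mult_mat_vec[OF A B(1), of "vec K v"] B by simp
  have "(\<Sum>i<K. (?s $ i / real (Suc i)) * real (Suc i) ^ Suc k) = v k" if "k < K" for k
  proof -
    have "v k = (?A *\<^sub>v ?s) $ k" unfolding s using that by simp
    also have "\<dots> = (\<Sum>i<K. real (Suc i) ^ k * ?s $ i)"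
      using that B(1) by (simp add: scalar_prod_def atLeast0LessThan)
    also have "\<dots> = (\<Sum>i<K. (?s $ i / real (Suc i)) * real (Suc i) ^ Suc k)"
      by (intro sum.cong refl) (simp add: field_simps)
    finally show ?thesis ..
  qed
  then show ?thesis by (intro exI[of _ "\<lambda>i. ?s $ i / real (Suc i)"]) blast
qed

text \<open>Repeating the points \<open>1, \<dots>, K\<close> with multiplicities makes the power sums linear in the
  multiplicities. A relation between them, being polynomial in the multiplicities, then holds for
  real multiplicities too, and these give the power sums arbitrary values.\<close>

lemma power_sums_independent:
  fixes f :: "real mpoly"
  assumes "\<And>N. 1 \<le> N \<Longrightarrow> subst (\<lambda>k. power_sum (Suc k) N) f = 0"
  shows "f = 0"
proof -
  let ?ev = "mpoly_eval (\<lambda>x::real. x)"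
  let ?vars = "\<Union>m\<in>Poly_Mapping.keys f. Poly_Mapping.keys m"
  obtain K where K: "?vars \<subseteq> {..<K}"
    using finite_nat_iff_bounded[of ?vars] by auto
  define V :: "(nat \<Rightarrow> real) \<Rightarrow> nat \<Rightarrow> real" where
    "V = (\<lambda>r k. \<Sum>i<K. r i * real (Suc i) ^ Suc k)"
  have nat: "?ev (V (\<lambda>i. real (\<mu> i))) f = 0" for \<mu> :: "nat \<Rightarrow> nat"
  proof -
    obtain xs where xs: "\<And>k. (\<Sum>x\<leftarrow>xs. x ^ Suc k) = (\<Sum>i<K. real (\<mu> i) * real (Suc i) ^ Suc k)"
      using points_with_multiplicities by blast
    interpret e: comm_ring_hom "?ev (\<lambda>i. (xs @ [0]) ! i)" by (rule mpoly_eval_hom[OF id_hom])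
    \<comment> \<open>The additional point \<open>0\<close> does not change the power sums; it ensures at least one variable.\<close>
    have "?ev (\<lambda>i. (xs @ [0]) ! i) (power_sum (Suc k) (Suc (length xs))) = V (\<lambda>i. real (\<mu> i)) k" for k
    proof -
      have "?ev (\<lambda>i. (xs @ [0]) ! i) (power_sum (Suc k) (Suc (length xs))) =
          (\<Sum>i<Suc (length xs). (xs @ [0]) ! i ^ Suc k)"
        unfolding power_sum_def e.hom_sum e.hom_power mpoly_eval_Var[OF id_hom] ..
      also have "\<dots> = (\<Sum>i<length xs. xs ! i ^ Suc k)"
        by (simp add: nth_append)
      also have "\<dots> = (\<Sum>x\<leftarrow>xs. x ^ Suc k)"
        by (simp add: sum_list_sum_nth atLeast0LessThan)
      finally show ?thesis unfolding V_def xs .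
    qed
    then have "?ev (V (\<lambda>i. real (\<mu> i))) f =
        ?ev (\<lambda>i. (xs @ [0]) ! i) (subst (\<lambda>k. power_sum (Suc k) (Suc (length xs))) f)"
      by (simp add: mpoly_eval_subst[OF id_hom])
    then show ?thesis using assms[of "Suc (length xs)"] by simp
  qed
  \<comment> \<open>The multiplicities are replaced by real numbers one at a time.\<close>
  have real: "?ev (V r) f = 0" if "\<forall>i. j \<le> i \<longrightarrow> r i \<in> \<nat>" for j r
    using that
  proof (induction j arbitrary: r)
    case 0
    then have "\<exists>\<mu>. \<forall>i. r i = real (\<mu> i)" by (intro choice) (auto elim!: Nats_cases)
    then obtain \<mu> where "r = (\<lambda>i. real (\<mu> i))" by auto
    then show ?case using nat by simp
  next
    case (Suc j)
    define P where "P = mpoly_eval (\<lambda>c. [:c:])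
      (\<lambda>k. \<Sum>i<K. (if i = j then [:0, 1:] else [:r i:]) * [:real (Suc i) ^ Suc k:]) f"
    have P: "poly P t = ?ev (V (r(j := t))) f" for t
    proof -
      have "poly (\<Sum>i<K. (if i = j then [:0, 1:] else [:r i:]) * [:real (Suc i) ^ Suc k:]) t =
          V (r(j := t)) k" for k
        unfolding V_def poly_sum by (intro sum.cong refl) auto
      then show ?thesis
        unfolding P_def mpoly_eval_def poly_sum poly_mult poly_prod poly_power by simp
    qed
    have "poly P (real n) = 0" for n
      unfolding P by (rule Suc.IH) (use Suc.prems in auto)
    then have "P = 0" by (rule polynomial_zero_if_zero_on_nat)
    then show ?case using P[of "r j"] by simp
  qed
  have "?ev v f = 0" for v
  proof -
    obtain r where r: "\<forall>k<K. V r k = v k"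
      using vandermonde_solve unfolding V_def by blast
    have "?ev v f = ?ev (V r) f"
      unfolding mpoly_eval_def
      by (intro sum.cong refl arg_cong2[of _ _ _ _ "(*)"] prod.cong) (use r K in auto)
    also have "\<dots> = ?ev (V (\<lambda>i. if i < K then r i else 0)) f"
      unfolding V_def by simp
    also have "\<dots> = 0"
      by (rule real[of K]) auto
    finally show ?thesis .
  qed
  then show ?thesis by (rule mpoly_eq_0I)
qed

lemma lead_p_star: "lead (\<lambda>_. 1) (Suc k) (p_star (Suc k) N) (power_sum (Suc k) N)"
  unfolding p_star_def power_sum_def
proof (rule lead_sum)
  fix i
  let ?c = "- real i - 1 / 2"
  have "lead (\<lambda>_. 1) (1 * Suc k) ((Var i + Const ?c) ^ Suc k + Const (- (?c ^ Suc k))) (Var i ^ Suc k)"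
    by (rule lead_add_lower[OF lead_power[OF lead_Var_plus_Const]]) (simp add: deg_below_Const)
  then show "lead (\<lambda>_. 1) (Suc k) ((Var i + Const ?c) ^ Suc k - Const ?c ^ Suc k) (Var i ^ Suc k)"
    by (simp only: Const_hom.hom_uminus Const_hom.hom_power mult_1 add_uminus_conv_diff)
qed

lemma lead_power_sum: "lead (\<lambda>_. 1) (Suc k) (power_sum (Suc k) N) (power_sum (Suc k) N :: real mpoly)"
  using lead_homogeneous[OF lead_p_star] .

text \<open>Hence the modified power sums are independent too: the leading forms of the generators are
  the power sums.\<close>

lemma p_star_independent:
  fixes f :: "real mpoly"
  assumes "\<And>N. 1 \<le> N \<Longrightarrow> subst (\<lambda>k. p_star (Suc k) N) f = 0"
  shows "f = 0"
proof -
  have "f \<in> deg_below Suc 0"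
  proof (rule deg_below_descent)
    fix d assume "f \<in> deg_below Suc (Suc d)"
    then have "lead Suc d f (hcomp Suc d f)" by (rule lead_hcomp)
    then have lead: "lead (\<lambda>_. 1) d (subst (\<lambda>k. p_star (Suc k) N) f)
        (subst (\<lambda>k. power_sum (Suc k) N) (hcomp Suc d f))" for N
      by (rule lead_subst) (rule lead_p_star)
    have "subst (\<lambda>k. power_sum (Suc k) N) (hcomp Suc d f) = 0" if "1 \<le> N" for N
      by (rule lead_unique[OF lead]) (simp add: assms[OF that] lead_0_iff)
    then show "hcomp Suc d f = 0" by (rule power_sums_independent)
  qed
  then show ?thesis by (auto simp: deg_below_def)
qed

section \<open>Symmetric polynomials as polynomials in the power sums\<close>

text \<open>The polynomials in \<open>p\<^sub>1, p\<^sub>2, \<dots>\<close>, each taken in \<open>N\<close> variables.\<close>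

definition power_sum_polys :: "nat \<Rightarrow> real mpoly set" where
  "power_sum_polys N = range (subst (\<lambda>k. power_sum (Suc k) N))"

lemma power_sum_polys_add:
  "f \<in> power_sum_polys N \<Longrightarrow> g \<in> power_sum_polys N \<Longrightarrow> f + g \<in> power_sum_polys N"
  unfolding power_sum_polys_def by (auto simp flip: subst_hom.hom_add)

lemma power_sum_polys_mult:
  "f \<in> power_sum_polys N \<Longrightarrow> g \<in> power_sum_polys N \<Longrightarrow> f * g \<in> power_sum_polys N"
  unfolding power_sum_polys_def by (auto simp flip: subst_hom.hom_mult)

lemma power_sum_polys_diff:
  "f \<in> power_sum_polys N \<Longrightarrow> g \<in> power_sum_polys N \<Longrightarrow> f - g \<in> power_sum_polys N"
  unfolding power_sum_polys_def by (auto simp flip: subst_hom.hom_minus)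

lemma power_sum_polys_Const: "Const c \<in> power_sum_polys N"
  unfolding power_sum_polys_def by (rule range_eqI[of _ _ "Const c"]) simp

lemma power_sum_polys_sum:
  "(\<And>x. x \<in> A \<Longrightarrow> F x \<in> power_sum_polys N) \<Longrightarrow> sum F A \<in> power_sum_polys N"
  using power_sum_polys_Const[of 0 N]
  by (induction A rule: infinite_finite_induct) (auto intro: power_sum_polys_add)

lemma power_sum_polys_power_sum: "power_sum k N \<in> power_sum_polys N"
proof (cases k)
  case 0
  then have "power_sum k N = Const (real N)"
    by (simp add: power_sum_def Const_hom.hom_of_nat)
  then show ?thesis by (simp add: power_sum_polys_Const)
next
  case (Suc k')
  show ?thesis
    unfolding power_sum_polys_def by (rule range_eqI[of _ _ "Var k'"]) (simp add: Suc)
qed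

lemma power_sum_polys_divide:
  assumes "of_nat n * f \<in> power_sum_polys N" "n \<noteq> 0"
  shows "f \<in> power_sum_polys N"
proof -
  have "f = Const (1 / real n) * (Const (real n) * f)"
    using assms(2) by (simp flip: mult.assoc Const_hom.hom_mult)
  also have "\<dots> = Const (1 / real n) * (of_nat n * f)"
    by (simp only: Const_hom.hom_of_nat)
  finally show ?thesis
    using power_sum_polys_mult[OF power_sum_polys_Const assms(1)] by metis
qed

text \<open>Sums over permutations of monomials in the first \<open>k\<close> variables. Multiplying by a power sum
  either adds a further variable or raises the exponent of one already present.\<close>

lemma symmetrized_monomial:
  assumes "k \<le> N"
  shows "(\<Sum>\<sigma> | \<sigma> permutes {..<N}. \<Prod>i<k. Var (\<sigma> i) ^ a i) \<in> power_sum_polys N"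
  using assms
proof (induction k arbitrary: a)
  case 0
  show ?case
    using power_sum_polys_Const[of "real (card {\<sigma>. \<sigma> permutes {..<N}})" N]
    by (simp add: Const_hom.hom_of_nat)
next
  case (Suc k)
  let ?Per = "{\<sigma>. \<sigma> permutes {..<N}}"
  let ?F = "\<lambda>\<sigma>. \<Prod>i<k. Var (\<sigma> i) ^ a i :: real mpoly"
  define S where "S = (\<lambda>j. \<Sum>\<sigma>\<in>?Per. ?F \<sigma> * Var (\<sigma> j) ^ a k)"
  have raise: "S j \<in> power_sum_polys N" if "j < k" for j
  proof -
    have "?F \<sigma> * Var (\<sigma> j) ^ a k = (\<Prod>i<k. Var (\<sigma> i) ^ (a(j := a j + a k)) i)" for \<sigma>
    proof -
      have "(\<Prod>i<k. Var (\<sigma> i) ^ (a(j := a j + a k)) i :: real mpoly) =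
          (\<Prod>i<k. Var (\<sigma> i) ^ a i * (if i = j then Var (\<sigma> j) ^ a k else 1))"
        by (intro prod.cong) (auto simp: power_add)
      then show ?thesis using that by (simp add: prod.distrib)
    qed
    then show ?thesis
      unfolding S_def using Suc.IH[of "a(j := a j + a k)"] Suc.prems by simp
  qed
  \<comment> \<open>The variables not yet used contribute equally.\<close>
  have same: "S j = S k" if "k \<le> j" "j < N" for j
  proof -
    let ?t = "transpose k j"
    have t: "?t permutes {..<N}"
      using that by (intro permutes_swap_id) auto
    have "S j = (\<Sum>\<sigma>\<in>?Per. ?F (\<sigma> \<circ> ?t) * Var ((\<sigma> \<circ> ?t) j) ^ a k)"
      unfolding S_def
      by (rule sum.reindex_bij_witness[where i = "\<lambda>\<sigma>. \<sigma> \<circ> ?t" and j = "\<lambda>\<sigma>. \<sigma> \<circ> ?t"])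
        (auto simp: o_assoc[symmetric] permutes_compose[OF t])
    also have "\<dots> = S k"
    proof -
      have "(\<Prod>i<k. Var ((\<sigma> \<circ> ?t) i) ^ a i :: real mpoly) = ?F \<sigma>" for \<sigma>
        using that by (intro prod.cong) (auto simp: transpose_def)
      then show ?thesis unfolding S_def by simp
    qed
    finally show ?thesis .
  qed
  have "(\<Sum>j<N. S j) = (\<Sum>\<sigma>\<in>?Per. ?F \<sigma> * power_sum (a k) N)"
  proof -
    have "(\<Sum>j<N. Var (\<sigma> j) ^ a k) = (power_sum (a k) N :: real mpoly)" if "\<sigma> \<in> ?Per" for \<sigma>
      using sum.permute[of \<sigma> "{..<N}" "\<lambda>j. Var j ^ a k :: real mpoly"] that
      by (simp add: power_sum_def o_def)
    then show ?thesis
      unfolding S_def by (subst sum.swap) (simp flip: sum_distrib_left)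
  qed
  also have "\<dots> = power_sum (a k) N * (\<Sum>\<sigma>\<in>?Per. ?F \<sigma>)"
    by (simp add: sum_distrib_left mult.commute)
  finally have total: "(\<Sum>j<N. S j) \<in> power_sum_polys N"
    using power_sum_polys_mult[OF power_sum_polys_power_sum Suc.IH] Suc.prems by simp
  have "{..<N} = {..<k} \<union> {k..<N}"
    using Suc.prems by auto
  then have "(\<Sum>j<N. S j) = (\<Sum>j<k. S j) + (\<Sum>j\<in>{k..<N}. S j)"
    by (simp add: sum.union_disjoint ivl_disj_int)
  also have "(\<Sum>j\<in>{k..<N}. S j) = (\<Sum>j\<in>{k..<N}. S k)"
    by (intro sum.cong refl same) simp_all
  also have "\<dots> = of_nat (N - k) * S k"
    by simp
  finally have "of_nat (N - k) * S k = (\<Sum>j<N. S j) - (\<Sum>j<k. S j)"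
    by simp
  also have "\<dots> \<in> power_sum_polys N"
    by (intro power_sum_polys_diff total power_sum_polys_sum raise) simp
  finally have "S k \<in> power_sum_polys N"
    by (rule power_sum_polys_divide) (use Suc.prems in auto)
  then show ?case by (simp add: S_def)
qed

text \<open>Only the first \<open>N\<close> variables occur. The encoding as invariance under a substitution is a ring
  theoretic condition, hence easy to establish for quotients.\<close>

definition vars_below :: "nat \<Rightarrow> 'a::comm_ring_1 mpoly \<Rightarrow> bool" where
  "vars_below N f \<longleftrightarrow> subst (\<lambda>i. if i \<in> {..<N} then Var i else 0) f = f"

lemma vars_below_keys:
  assumes "vars_below N f" "m \<in> Poly_Mapping.keys f"
  shows "Poly_Mapping.keys m \<subseteq> {..<N}"
  using assms lookup_subst_restrict[of "{..<N}" f m]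
  by (auto simp: vars_below_def in_keys_iff split: if_splits)

lemma subst_cong_vars_below:
  assumes "vars_below N f" "\<And>i. i < N \<Longrightarrow> a i = b i"
  shows "subst a f = subst b f"
  using assms(2) vars_below_keys[OF assms(1)] by (intro subst_cong) auto

text \<open>Invariance under permutations of the first \<open>N\<close> variables.\<close>

definition sym_in :: "nat \<Rightarrow> 'a::comm_ring_1 mpoly \<Rightarrow> bool" where
  "sym_in N f \<longleftrightarrow> (\<forall>\<sigma>. \<sigma> permutes {..<N} \<longrightarrow> subst (\<lambda>i. Var (\<sigma> i)) f = f)"

text \<open>A symmetric polynomial is its own average over all permutations of the variables.\<close>

lemma symmetric_in_power_sums:
  assumes "sym_in N F" "vars_below N F"
  shows "F \<in> power_sum_polys N"
proof -
  let ?Per = "{\<sigma>. \<sigma> permutes {..<N}}"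
  have "of_nat (fact N) * F = (\<Sum>\<sigma>\<in>?Per. F)"
    using card_permutations[of "{..<N}" N] by simp
  also have "\<dots> = (\<Sum>\<sigma>\<in>?Per. subst (\<lambda>i. Var (\<sigma> i)) F)"
    using assms(1) by (intro sum.cong) (auto simp: sym_in_def)
  also have "\<dots> = (\<Sum>\<sigma>\<in>?Per. \<Sum>m\<in>Poly_Mapping.keys F. Const (Poly_Mapping.lookup F m) *
      (\<Prod>i<N. Var (\<sigma> i) ^ Poly_Mapping.lookup m i))"
    unfolding subst_def
    by (intro sum.cong refl arg_cong2[of _ _ _ _ "(*)"] prod_keys_superset finite_lessThan
        vars_below_keys[OF assms(2)])
  also have "\<dots> = (\<Sum>m\<in>Poly_Mapping.keys F. Const (Poly_Mapping.lookup F m) *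
      (\<Sum>\<sigma>\<in>?Per. \<Prod>i<N. Var (\<sigma> i) ^ Poly_Mapping.lookup m i))"
    by (subst sum.swap) (simp only: sum_distrib_left)
  also have "\<dots> \<in> power_sum_polys N"
    by (intro power_sum_polys_sum power_sum_polys_mult power_sum_polys_Const symmetrized_monomial order_refl)
  finally show ?thesis
    by (rule power_sum_polys_divide) simp
qed

text \<open>Components of \<open>f\<close> of degree above that of \<open>F\<close> map to zero and can be dropped.\<close>

lemma power_sum_polys_degree:
  assumes "F \<in> power_sum_polys N" "F \<in> deg_below (\<lambda>_. 1) (Suc n)"
  shows "\<exists>f\<in>deg_below Suc (Suc n). subst (\<lambda>k. power_sum (Suc k) N) f = F"
proof -
  obtain f where f: "subst (\<lambda>k. power_sum (Suc k) N) f = F"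
    using assms(1) by (auto simp: power_sum_polys_def)
  obtain D where "f \<in> deg_below Suc D" using deg_below_ex by blast
  then show ?thesis using f
  proof (induction D arbitrary: f)
    case 0
    then show ?case using deg_below_mono[of f Suc 0 "Suc n"] by auto
  next
    case (Suc d)
    show ?case
    proof (cases "Suc d \<le> Suc n")
      case True
      then show ?thesis using Suc.prems deg_below_mono[of f Suc "Suc d" "Suc n"] by blast
    next
      case False
      let ?g = "hcomp Suc d f"
      have lead: "lead Suc d f ?g" using Suc.prems(1) by (rule lead_hcomp)
      have "lead (\<lambda>_. 1) d F (subst (\<lambda>k. power_sum (Suc k) N) ?g)"
        unfolding Suc.prems(2)[symmetric] by (rule lead_subst[OF lead]) (rule lead_power_sum)
      moreover have "lead (\<lambda>_. 1) d F 0"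
        unfolding lead_0_iff by (rule deg_below_mono[OF assms(2)]) (use False in simp)
      ultimately have "subst (\<lambda>k. power_sum (Suc k) N) ?g = 0"
        by (rule lead_unique)
      then have "subst (\<lambda>k. power_sum (Suc k) N) (f - ?g) = F"
        by (simp add: subst_hom.hom_minus Suc.prems(2))
      moreover have "f - ?g \<in> deg_below Suc d"
        using lead by (simp add: lead_def)
      ultimately show ?thesis by (intro Suc.IH)
    qed
  qed
qed

section \<open>The Frobenius-Schur functions\<close>

lemma deg_below_Var_plus_Const: "Var i + Const c \<in> deg_below (\<lambda>_. 1) (Suc 1)"
  by (rule lead_deg_below[OF lead_Var_plus_Const])

lemma lead_shifted_schur:
  assumes "young \<nu>"
  shows "lead (\<lambda>_. 1) (psize \<nu>) (shifted_schur_poly \<nu> N) (schur_poly \<nu> N)"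
proof -
  have "lead (\<lambda>_. 1) 1 (shift_up N i) (Var i)" for i
    using lead_Var_plus_Const[of i "of_nat (N - Suc i)"]
    by (simp add: shift_up_def Const_hom.hom_of_nat)
  then have "lead (\<lambda>_. 1) (psize \<nu>) (shifted_schur_poly \<nu> N) (subst Var (schur_poly \<nu> N))"
    unfolding shifted_schur_poly_eq by (intro lead_subst[OF lead_factorial_schur[OF assms]])
  then show ?thesis
    by (simp only: subst_Var_id)
qed

lemma subst_p_star_deg:
  "f \<in> deg_below Suc (Suc n) \<Longrightarrow> subst (\<lambda>k. p_star (Suc k) N) f \<in> deg_below (\<lambda>_. 1) (Suc n)"
  by (erule deg_below_subst) (rule lead_deg_below[OF lead_p_star])

text \<open>For a fixed number of variables only; \<open>f\<close> may still depend on \<open>N\<close>.\<close>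

lemma shifted_schur_in_p_star:
  assumes "young \<nu>"
  shows "\<exists>f\<in>deg_below Suc (Suc (psize \<nu>)). subst (\<lambda>k. p_star (Suc k) N) f = shifted_schur_poly \<nu> N"
proof -
  let ?Q = "factorial_schur_poly \<nu> N"
  let ?c = "real N - 1 / 2"
  \<comment> \<open>Translating all variables by the same constant keeps the symmetry.\<close>
  let ?Q' = "subst (\<lambda>i. Var i + Const ?c) ?Q"
  define u where "u = (\<lambda>i. Var i + Const (- real i - 1 / 2))"
  have vars: "vars_below N ?Q"
    using factorial_schur_vars by (simp add: vars_below_def)
  have "sym_in N ?Q'"
    unfolding sym_in_def
  proof (intro allI impI)
    fix \<sigma> assume \<sigma>: "\<sigma> permutes {..<N}"
    have "subst (\<lambda>i. Var (\<sigma> i)) ?Q' = subst (\<lambda>i. Var i + Const ?c) (subst (\<lambda>i. Var (\<sigma> i)) ?Q)"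
      by (simp add: subst_subst subst_hom.hom_add)
    then show "subst (\<lambda>i. Var (\<sigma> i)) ?Q' = ?Q'"
      by (simp add: factorial_schur_symmetric[OF \<sigma>])
  qed
  moreover have "vars_below N ?Q'"
    unfolding vars_below_def subst_subst
    by (rule subst_cong_vars_below[OF vars]) (simp add: subst_hom.hom_add)
  ultimately have "?Q' \<in> power_sum_polys N"
    by (rule symmetric_in_power_sums)
  moreover have "?Q' \<in> deg_below (\<lambda>_. 1) (Suc (psize \<nu>))"
    by (rule deg_below_subst[OF lead_deg_below[OF lead_factorial_schur[OF assms]]])
      (rule deg_below_Var_plus_Const)
  ultimately obtain f where f: "f \<in> deg_below Suc (Suc (psize \<nu>))"
      "subst (\<lambda>k. power_sum (Suc k) N) f = ?Q'"
    using power_sum_polys_degree by blast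
  define C where "C = (\<lambda>k. \<Sum>i<N. (- real i - 1 / 2) ^ Suc k)"
  have "shifted_schur_poly \<nu> N = subst u ?Q'"
    unfolding shifted_schur_poly_eq subst_subst
  proof (rule subst_cong_vars_below[OF vars])
    fix i assume "i < N"
    then have "real (N - Suc i) = (- real i - 1 / 2) + ?c"
      by (simp add: of_nat_diff)
    then have "Const (real (N - Suc i)) = Const (- real i - 1 / 2) + Const ?c"
      by (simp only: Const_hom.hom_add)
    then show "shift_up N i = subst u (Var i + Const ?c)"
      by (simp add: shift_up_def u_def subst_hom.hom_add Const_hom.hom_of_nat add.assoc)
  qed
  also have "\<dots> = subst (\<lambda>k. subst u (power_sum (Suc k) N)) f"
    by (simp add: subst_subst flip: f(2))
  also have "(\<lambda>k. subst u (power_sum (Suc k) N)) = (\<lambda>k. p_star (Suc k) N + Const (C k))"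
    by (simp add: power_sum_def p_star_def C_def u_def subst_hom.hom_sum subst_hom.hom_power sum_subtractf
        Const_hom.hom_sum Const_hom.hom_power del: power_Suc)
  also have "subst \<dots> f = subst (\<lambda>k. p_star (Suc k) N) (subst (\<lambda>k. Var k + Const (C k)) f)"
    by (simp add: subst_subst subst_hom.hom_add)
  finally have "shifted_schur_poly \<nu> N = subst (\<lambda>k. p_star (Suc k) N) (subst (\<lambda>k. Var k + Const (C k)) f)" .
  moreover have "subst (\<lambda>k. Var k + Const (C k)) f \<in> deg_below Suc (Suc (psize \<nu>))"
    by (rule deg_below_subst[OF f(1)])
      (intro deg_below_add deg_below_Const lead_deg_below[OF lead_Var])
  ultimately show ?thesis by metis
qed

lemma p_star_stable:
  "subst (\<lambda>i. if i = N then 0 else Var i) (p_star (Suc k) (Suc N)) = p_star (Suc k) N"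
proof -
  have "subst (\<lambda>i. if i = N then 0 else Var i) (p_star (Suc k) (Suc N)) =
    (\<Sum>i<Suc N. ((if i = N then 0 else Var i) + Const (- real i - 1/2)) ^ Suc k - Const (- real i - 1/2) ^ Suc k)"
    unfolding p_star_def
    by (simp only: subst_hom.hom_sum subst_hom.hom_minus subst_hom.hom_power subst_hom.hom_add subst_Const subst_Var)
  also have "\<dots> = p_star (Suc k) N"
    by (simp add: p_star_def del: power_Suc)
  finally show ?thesis .
qed

text \<open>A symmetric polynomial that vanishes when one of the \<open>N + 1\<close> variables is set to zero has only
  monomials divisible by all these variables, so it is zero if its degree is at most \<open>N\<close>.\<close>

lemma symmetric_vanishing:
  assumes "sym_in (Suc N) X" "X \<in> deg_below (\<lambda>_. 1) (Suc N)"
    and "subst (\<lambda>i. if i = N then 0 else Var i) X = 0"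
  shows "X = 0"
proof (rule ccontr)
  assume "X \<noteq> 0"
  then obtain m where m: "m \<in> Poly_Mapping.keys X"
    by (metis keys_eq_empty ex_in_conv)
  have "j \<in> Poly_Mapping.keys m" if j: "j < Suc N" for j
  proof (rule ccontr)
    assume "j \<notin> Poly_Mapping.keys m"
    then have sub: "Poly_Mapping.keys m \<subseteq> - {j}" by auto
    let ?t = "transpose j N"
    have t: "?t permutes {..<Suc N}"
      using j by (intro permutes_swap_id) auto
    have "subst (\<lambda>i. if i \<in> - {j} then Var i else 0) X =
        subst (\<lambda>i. if i \<in> - {j} then Var i else 0) (subst (\<lambda>i. Var (?t i)) X)"
      using assms(1) t by (simp add: sym_in_def)
    also have "\<dots> = subst (\<lambda>i. Var (?t i)) (subst (\<lambda>i. if i = N then 0 else Var i) X)"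
      unfolding subst_subst by (rule arg_cong[of _ _ "\<lambda>a. subst a X"]) (auto simp: transpose_def)
    also have "\<dots> = 0" by (simp add: assms(3))
    finally show False
      using lookup_subst_restrict[of "- {j}" X m] sub m by (simp add: in_keys_iff)
  qed
  then have "{..<Suc N} \<subseteq> Poly_Mapping.keys m" by auto
  then have "Suc N \<le> card (Poly_Mapping.keys m)"
    using card_mono[of "Poly_Mapping.keys m" "{..<Suc N}"] by simp
  also have "card (Poly_Mapping.keys m) \<le> mdeg (\<lambda>_. 1) m"
    unfolding mdeg_def card_eq_sum by (intro sum_mono) (simp add: in_keys_iff)
  finally show False using assms(2) m by (auto simp: deg_below_def)
qed

text \<open>In the variables \<open>x\<close>, all variables in \<open>p\<^sub>k\<^sup>*\<close> are shifted by the same constant.\<close>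

lemma shift_down_p_star_symmetric:
  "sym_in N (subst (shift_down N) (p_star (Suc k) N))"
  unfolding sym_in_def
proof (intro allI impI)
  fix \<sigma> assume \<sigma>: "\<sigma> permutes {..<N}"
  let ?c = "1 / 2 - real N"
  let ?C = "\<Sum>i<N. Const (- real i - 1/2) ^ Suc k"
  have "shift_down N i + Const (- real i - 1/2) = Var i + Const ?c" if "i < N" for i
  proof -
    have "- real i - 1/2 = real (N - Suc i) + ?c"
      using that by (simp add: of_nat_diff)
    then have "Const (- real i - 1/2) = Const (real (N - Suc i)) + Const ?c"
      by (simp only: Const_hom.hom_add)
    then show ?thesis by (simp add: shift_down_def Const_hom.hom_of_nat)
  qed
  then have eq: "subst (shift_down N) (p_star (Suc k) N) = (\<Sum>i<N. (Var i + Const ?c) ^ Suc k) - ?C"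
    unfolding p_star_def sum_subtractf
    by (simp add: subst_hom.hom_sum subst_hom.hom_minus subst_hom.hom_power subst_hom.hom_add del: power_Suc)
  have "(\<Sum>i<N. (Var (\<sigma> i) + Const ?c) ^ Suc k) = (\<Sum>i<N. (Var i + Const ?c) ^ Suc k)"
    using sum.permute[OF \<sigma>, of "\<lambda>i. (Var i + Const ?c) ^ Suc k"] by (simp add: o_def del: power_Suc)
  then show "subst (\<lambda>i. Var (\<sigma> i)) (subst (shift_down N) (p_star (Suc k) N)) =
      subst (shift_down N) (p_star (Suc k) N)"
    unfolding eq
    by (simp add: subst_hom.hom_sum subst_hom.hom_minus subst_hom.hom_power subst_hom.hom_add del: power_Suc)
qed

text \<open>The expression found for \<open>|\<nu>| + 1\<close> variables works for every number of variables: for fewer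
  variables by stability; for more variables because the difference of both sides, being symmetric in
  the variables \<open>x\<close> and of degree at most \<open>|\<nu>|\<close>, vanishes when the last variable is set to zero.\<close>

lemma FS_exists:
  assumes "young \<nu>"
  shows "\<exists>f\<in>deg_below Suc (Suc (psize \<nu>)). \<forall>N\<ge>1. subst (\<lambda>k. p_star (Suc k) N) f = shifted_schur_poly \<nu> N"
proof -
  let ?n = "psize \<nu>"
  let ?z = "\<lambda>N i. if i = N then 0 else Var i :: real mpoly"
  obtain f where f: "f \<in> deg_below Suc (Suc ?n)"
    and base: "subst (\<lambda>k. p_star (Suc k) (Suc ?n)) f = shifted_schur_poly \<nu> (Suc ?n)"
    using shifted_schur_in_p_star[OF assms] by blast
  define T where "T = (\<lambda>N. subst (\<lambda>k. p_star (Suc k) N) f - shifted_schur_poly \<nu> N)"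
  have restrict: "subst (?z N) (T (Suc N)) = T N" for N
    by (simp add: T_def subst_hom.hom_minus subst_subst p_star_stable shifted_schur_stable[OF assms])
  have up: "T (Suc N) = 0" if "T N = 0" "?n < Suc N" for N
  proof -
    define X where "X = subst (shift_down (Suc N)) (T (Suc N))"
    have TX: "T (Suc N) = subst (shift_up (Suc N)) X"
      by (simp add: X_def)
    have "sym_in (Suc N) X"
      unfolding sym_in_def
    proof (intro allI impI)
      fix \<sigma> assume \<sigma>: "\<sigma> permutes {..<Suc N}"
      have "subst (\<lambda>i. Var (\<sigma> i)) (subst (shift_down (Suc N)) (p_star (Suc k) (Suc N))) =
          subst (shift_down (Suc N)) (p_star (Suc k) (Suc N))" for k
        using shift_down_p_star_symmetric \<sigma> by (simp add: sym_in_def)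
      moreover have "X = subst (\<lambda>k. subst (shift_down (Suc N)) (p_star (Suc k) (Suc N))) f -
          factorial_schur_poly \<nu> (Suc N)"
        by (simp add: X_def T_def subst_hom.hom_minus subst_subst[of _ "\<lambda>k. p_star (Suc k) (Suc N)"]
            shifted_schur_poly_eq)
      ultimately show "subst (\<lambda>i. Var (\<sigma> i)) X = X"
        by (simp add: subst_hom.hom_minus factorial_schur_symmetric[OF \<sigma>]
            subst_subst[of _ "\<lambda>k. subst (shift_down (Suc N)) (p_star (Suc k) (Suc N))"])
    qed
    moreover have "X \<in> deg_below (\<lambda>_. 1) (Suc N)"
    proof -
      have "T (Suc N) \<in> deg_below (\<lambda>_. 1) (Suc ?n)"
        unfolding T_def
        by (intro deg_below_diff subst_p_star_deg f lead_deg_below[OF lead_shifted_schur[OF assms]])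
      then have "X \<in> deg_below (\<lambda>_. 1) (Suc ?n)"
        unfolding X_def
      proof (rule deg_below_subst)
        show "shift_down (Suc N) k \<in> deg_below (\<lambda>_. 1) (Suc 1)" for k
          using deg_below_Var_plus_Const[of k "- of_nat (Suc N - Suc k)"]
          by (simp add: shift_down_def Const_hom.hom_uminus Const_hom.hom_of_nat)
      qed
      then show ?thesis using that(2) by (auto intro: deg_below_mono)
    qed
    moreover have "subst (?z N) X = 0"
    proof -
      have "subst (shift_up (Suc N)) (subst (?z N) X) = subst (?z N) (subst (shift_up (Suc N)) X)"
        unfolding subst_subst
        by (rule arg_cong[of _ _ "\<lambda>a. subst a X"])
          (auto simp: shift_up_def subst_hom.hom_add subst_hom.hom_of_nat)
      also have "\<dots> = 0" by (simp add: restrict that(1) flip: TX)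
      finally show ?thesis by (simp add: subst_shift_up_eq_0)
    qed
    ultimately have "X = 0" by (rule symmetric_vanishing)
    then show ?thesis by (simp add: TX)
  qed
  have down: "T N = 0" if "T (Suc N) = 0" for N
    using restrict[of N] that by simp
  have "T N = 0" for N
  proof (cases "Suc ?n \<le> N")
    case True
    then show ?thesis
      by (induction N rule: dec_induct) (auto simp: base up, simp add: T_def base)
  next
    case False
    then have "N \<le> Suc ?n" by simp
    then show ?thesis
      by (induction N rule: inc_induct) (auto intro: down, simp add: T_def base)
  qed
  then show ?thesis using f by (auto simp: T_def)
qed

lemma FS_spec:
  assumes "young \<nu>"
  shows "FS \<nu> \<in> deg_below Suc (Suc (psize \<nu>))"
    and "1 \<le> N \<Longrightarrow> subst (\<lambda>k. p_star (Suc k) N) (FS \<nu>) = shifted_schur_poly \<nu> N"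
proof -
  obtain f where f: "f \<in> deg_below Suc (Suc (psize \<nu>))"
    "\<forall>N\<ge>1. subst (\<lambda>k. p_star (Suc k) N) f = shifted_schur_poly \<nu> N"
    using FS_exists[OF assms] by blast
  have "FS \<nu> = f"
    unfolding FS_def shifted_sym_iso_def
  proof (rule the_equality)
    fix g assume "\<forall>N\<ge>1. subst (\<lambda>k. p_star (Suc k) N) g = shifted_schur_poly \<nu> N"
    with f(2) have "subst (\<lambda>k. p_star (Suc k) N) (g - f) = 0" if "1 \<le> N" for N
      using that by (simp add: subst_hom.hom_minus)
    then have "g - f = 0" by (rule p_star_independent)
    then show "g = f" by simp
  qed (rule f(2))
  then show "FS \<nu> \<in> deg_below Suc (Suc (psize \<nu>))"
    "1 \<le> N \<Longrightarrow> subst (\<lambda>k. p_star (Suc k) N) (FS \<nu>) = shifted_schur_poly \<nu> N"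
    using f by simp_all
qed

text \<open>The substitution of \<open>p\<^sub>k\<^sup>*\<close> into the Frobenius-Schur function has the leading form obtained by
  substituting \<open>p\<^sub>k\<close> into its component of degree \<open>|\<nu>|\<close>; on the other hand it is the shifted Schur
  polynomial, with leading form the Schur polynomial.\<close>

lemma lead_FS:
  assumes "young \<nu>"
  shows "lead Suc (psize \<nu>) (FS \<nu>) (Schur \<nu>)"
proof -
  let ?g = "hcomp Suc (psize \<nu>) (FS \<nu>)"
  have lead: "lead Suc (psize \<nu>) (FS \<nu>) ?g"
    by (rule lead_hcomp[OF FS_spec(1)[OF assms]])
  have g: "subst (\<lambda>k. power_sum (Suc k) N) ?g = schur_poly \<nu> N" if "1 \<le> N" for N
  proof (rule lead_unique)
    show "lead (\<lambda>_. 1) (psize \<nu>) (shifted_schur_poly \<nu> N) (subst (\<lambda>k. power_sum (Suc k) N) ?g)"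
      unfolding FS_spec(2)[OF assms that, symmetric] by (rule lead_subst[OF lead]) (rule lead_p_star)
  qed (rule lead_shifted_schur[OF assms])
  have "Schur \<nu> = ?g"
    unfolding Schur_def sym_of_seq_def
  proof (rule the_equality)
    fix h assume "\<forall>N\<ge>1. subst (\<lambda>k. power_sum (Suc k) N) h = schur_poly \<nu> N"
    with g have "subst (\<lambda>k. power_sum (Suc k) N) (h - ?g) = 0" if "1 \<le> N" for N
      using that by (simp add: subst_hom.hom_minus)
    then have "h - ?g = 0" by (rule power_sums_independent)
    then show "h = ?g" by simp
  qed (simp add: g)
  then show ?thesis using lead by simp
qed

section \<open>The limit transitions\<close>

lemma monom_degree_eq_mdeg: "monom_degree = mdeg Suc"
  by (rule ext) (simp add: monom_degree_def mdeg_def)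

lemma lookup_complexify: "Poly_Mapping.lookup (complexify f) m = of_real (Poly_Mapping.lookup f m)"
  by (simp add: complexify_def Poly_Mapping.map.rep_eq when_def)

lemma lookup_eps_neg_G:
  "Poly_Mapping.lookup (eps_neg_G \<epsilon> f) m = inverse \<epsilon> ^ mdeg Suc m * Poly_Mapping.lookup f m"
  by (auto simp: eps_neg_G_def lookup_mapp when_def in_keys_iff monom_degree_eq_mdeg)

lemma lookup_FS_eps:
  "Poly_Mapping.lookup (FS_eps \<epsilon> \<nu>) m =
    \<epsilon> ^ psize \<nu> * inverse \<epsilon> ^ mdeg Suc m * of_real (Poly_Mapping.lookup (FS \<nu>) m)"
  by (simp add: FS_eps_def lookup_eps_neg_G lookup_complexify)

lemma FS_lookup_degree:
  assumes "young \<nu>" "psize \<nu> < mdeg Suc m"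
  shows "Poly_Mapping.lookup (FS \<nu>) m = 0"
  using FS_spec(1)[OF assms(1)] assms(2) by (force simp: deg_below_def in_keys_iff)

lemma FS_eps_lookup_tendsto:
  assumes "young \<nu>"
  shows "((\<lambda>\<epsilon>. Poly_Mapping.lookup (FS_eps \<epsilon> \<nu>) m) \<longlongrightarrow>
    Poly_Mapping.lookup (complexify (Schur \<nu>)) m) (at 0)"
proof (cases "mdeg Suc m \<le> psize \<nu>")
  case True
  let ?c = "of_real (Poly_Mapping.lookup (FS \<nu>) m) :: complex"
  have ev: "\<forall>\<^sub>F \<epsilon> in at 0. \<epsilon> ^ (psize \<nu> - mdeg Suc m) * ?c = Poly_Mapping.lookup (FS_eps \<epsilon> \<nu>) m"
    unfolding eventually_at_filter lookup_FS_eps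
    using True by (intro always_eventually) (auto simp: power_diff field_simps)
  have "((\<lambda>\<epsilon>. \<epsilon> ^ (psize \<nu> - mdeg Suc m) * ?c) \<longlongrightarrow> 0 ^ (psize \<nu> - mdeg Suc m) * ?c) (at 0)"
    by (intro tendsto_intros)
  \<comment> \<open>The power \<open>0 ^ 0 = 1\<close> keeps exactly the component of degree \<open>|\<nu>|\<close>.\<close>
  moreover have "0 ^ (psize \<nu> - mdeg Suc m) * ?c = Poly_Mapping.lookup (complexify (Schur \<nu>)) m"
    using True lead_lookup[OF lead_FS[OF assms], of m] by (auto simp: lookup_complexify power_0_left)
  ultimately have "((\<lambda>\<epsilon>. \<epsilon> ^ (psize \<nu> - mdeg Suc m) * ?c) \<longlongrightarrow>
      Poly_Mapping.lookup (complexify (Schur \<nu>)) m) (at 0)"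
    by (simp only:)
  then show ?thesis by (rule Lim_transform_eventually[OF _ ev])
next
  case False
  then show ?thesis
    using lead_lookup[OF lead_FS[OF assms], of m]
    by (simp add: lookup_FS_eps FS_lookup_degree[OF assms] lookup_complexify)
qed

lemma SymC_le_iff: "f \<in> SymC_le n \<longleftrightarrow> (\<forall>m. n < mdeg Suc m \<longrightarrow> Poly_Mapping.lookup f m = 0)"
  by (auto simp: SymC_le_def monom_degree_eq_mdeg in_keys_iff not_less[symmetric])

lemma psize_mono:
  assumes "young \<nu>" "\<mu> \<le> \<nu>"
  shows "psize \<mu> \<le> psize \<nu>"
proof -
  have fin: "finite {i. \<nu> i \<noteq> 0}" using assms(1) by (simp add: young_def)
  have le: "\<mu> i \<le> \<nu> i" for i using assms(2) by (simp add: le_fun_def)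
  have "psize \<mu> = (\<Sum>i | \<nu> i \<noteq> 0. \<mu> i)"
    unfolding psize_def
    using le by (intro sum.mono_neutral_left fin) (auto simp: Suc_le_eq intro: less_le_trans)
  also have "\<dots> \<le> psize \<nu>"
    unfolding psize_def by (intro sum_mono le)
  finally show ?thesis .
qed

lemma FS_eps_in_SymC_le:
  assumes "young \<nu>"
  shows "FS_eps \<epsilon> \<nu> \<in> SymC_le (psize \<nu>)" "complexify (Schur \<nu>) \<in> SymC_le (psize \<nu>)"
  using lead_lookup[OF lead_FS[OF assms]]
  by (auto simp: SymC_le_iff lookup_FS_eps FS_lookup_degree[OF assms] lookup_complexify)

text \<open>The coefficients of the Laguerre function; those of the Meixner function carry an additional
  power of \<open>\<xi> / (1 - \<xi>)\<close>.\<close>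

definition laguerre_coeff :: "complex \<Rightarrow> complex \<Rightarrow> (nat \<Rightarrow> nat) \<Rightarrow> (nat \<Rightarrow> nat) \<Rightarrow> complex" where
  "laguerre_coeff z z' \<nu> \<mu> = (-1) ^ (psize \<nu> - psize \<mu>) *
     (of_nat (skew_dim \<nu> \<mu>) / fact (psize \<nu> - psize \<mu>)) *
     content_prod z \<nu> \<mu> * content_prod z' \<nu> \<mu>"

lemma lookup_Laguerre:
  "Poly_Mapping.lookup (Laguerre z z' \<nu>) m = (\<Sum>\<mu> | young \<mu> \<and> \<mu> \<le> \<nu>.
     laguerre_coeff z z' \<nu> \<mu> * Poly_Mapping.lookup (complexify (Schur \<mu>)) m)"
  by (simp add: Laguerre_def lookup_sum laguerre_coeff_def)

text \<open>With \<open>\<xi> = 1 - \<epsilon>\<close>, the powers of \<open>\<xi> / (1 - \<xi>) = (1 - \<epsilon>) / \<epsilon>\<close> turn the prefactor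
  \<open>\<epsilon>\<close> to the power \<open>|\<nu>|\<close> into \<open>\<epsilon>\<close> to the power \<open>|\<mu>|\<close>.\<close>

lemma lookup_Meixner_eps:
  assumes "young \<nu>" "\<epsilon> \<noteq> 0"
  shows "Poly_Mapping.lookup (Meixner_eps z z' \<epsilon> \<nu>) m = (\<Sum>\<mu> | young \<mu> \<and> \<mu> \<le> \<nu>.
     laguerre_coeff z z' \<nu> \<mu> * (1 - \<epsilon>) ^ (psize \<nu> - psize \<mu>) * Poly_Mapping.lookup (FS_eps \<epsilon> \<mu>) m)"
  unfolding Meixner_eps_def Meixner_def lookup_Const_mult lookup_eps_neg_G lookup_sum sum_distrib_left
proof (intro sum.cong refl)
  fix \<mu> assume "\<mu> \<in> {\<mu>. young \<mu> \<and> \<mu> \<le> \<nu>}"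
  then have le: "psize \<mu> \<le> psize \<nu>" using psize_mono[OF assms(1)] by simp
  have "\<epsilon> ^ psize \<nu> * ((1 - \<epsilon>) / \<epsilon>) ^ (psize \<nu> - psize \<mu>) = (1 - \<epsilon>) ^ (psize \<nu> - psize \<mu>) * \<epsilon> ^ psize \<mu>"
    using assms(2) le by (simp add: power_divide power_diff)
  then have eq: "\<epsilon> ^ psize \<nu> * (((1 - \<epsilon>) / \<epsilon>) ^ (psize \<nu> - psize \<mu>) * x) =
      (1 - \<epsilon>) ^ (psize \<nu> - psize \<mu>) * (\<epsilon> ^ psize \<mu> * x)" for x
    by (simp add: mult.assoc[symmetric])
  let ?L = "inverse \<epsilon> ^ mdeg Suc m * of_real (Poly_Mapping.lookup (FS \<mu>) m)"
  have "\<epsilon> ^ psize \<nu> * (inverse \<epsilon> ^ mdeg Suc m *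
      ((-1) ^ (psize \<nu> - psize \<mu>) * ((1 - \<epsilon>) / \<epsilon>) ^ (psize \<nu> - psize \<mu>) *
       (of_nat (skew_dim \<nu> \<mu>) / fact (psize \<nu> - psize \<mu>)) *
       content_prod z \<nu> \<mu> * content_prod z' \<nu> \<mu> * of_real (Poly_Mapping.lookup (FS \<mu>) m))) =
     \<epsilon> ^ psize \<nu> * (((1 - \<epsilon>) / \<epsilon>) ^ (psize \<nu> - psize \<mu>) * (laguerre_coeff z z' \<nu> \<mu> * ?L))"
    by (simp only: laguerre_coeff_def mult_ac)
  also have "\<dots> = laguerre_coeff z z' \<nu> \<mu> * (1 - \<epsilon>) ^ (psize \<nu> - psize \<mu>) * Poly_Mapping.lookup (FS_eps \<epsilon> \<mu>) m"
    unfolding eq lookup_FS_eps by (simp only: mult_ac)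
  finally show "\<epsilon> ^ psize \<nu> * (inverse \<epsilon> ^ mdeg Suc m *
      ((-1) ^ (psize \<nu> - psize \<mu>) * ((1 - \<epsilon>) / (1 - (1 - \<epsilon>))) ^ (psize \<nu> - psize \<mu>) *
       (of_nat (skew_dim \<nu> \<mu>) / fact (psize \<nu> - psize \<mu>)) *
       content_prod z \<nu> \<mu> * content_prod z' \<nu> \<mu> * Poly_Mapping.lookup (complexify (FS \<mu>)) m)) =
     laguerre_coeff z z' \<nu> \<mu> * (1 - \<epsilon>) ^ (psize \<nu> - psize \<mu>) * Poly_Mapping.lookup (FS_eps \<epsilon> \<mu>) m"
    by (simp add: lookup_complexify)
qed

theorem proposition4p30:
  fixes \<nu> :: "nat \<Rightarrow> nat" and z z' :: complex
  assumes "young \<nu>"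
  shows "converges_in_SymC_le (psize \<nu>) (\<lambda>\<epsilon>. FS_eps \<epsilon> \<nu>) (complexify (Schur \<nu>)) \<and>
    converges_in_SymC_le (psize \<nu>) (\<lambda>\<epsilon>. Meixner_eps z z' \<epsilon> \<nu>) (Laguerre z z' \<nu>)"
proof
  show "converges_in_SymC_le (psize \<nu>) (\<lambda>\<epsilon>. FS_eps \<epsilon> \<nu>) (complexify (Schur \<nu>))"
    using FS_eps_in_SymC_le[OF assms] FS_eps_lookup_tendsto[OF assms]
    by (simp add: converges_in_SymC_le_def)
next
  let ?I = "{\<mu>. young \<mu> \<and> \<mu> \<le> \<nu>}"
  have in_le: "f \<in> SymC_le (psize \<nu>)" if "f \<in> SymC_le (psize \<mu>)" "\<mu> \<in> ?I" for f \<mu>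
    using that psize_mono[OF assms, of \<mu>] by (auto simp: SymC_le_iff)
  have "Meixner_eps z z' \<epsilon> \<nu> \<in> SymC_le (psize \<nu>)" if "\<epsilon> \<noteq> 0" for \<epsilon>
    unfolding SymC_le_iff lookup_Meixner_eps[OF assms that]
    using in_le[OF FS_eps_in_SymC_le(1)] by (auto simp: SymC_le_iff intro!: sum.neutral)
  moreover have "Laguerre z z' \<nu> \<in> SymC_le (psize \<nu>)"
    unfolding SymC_le_iff lookup_Laguerre
    using in_le[OF FS_eps_in_SymC_le(2)] by (auto simp: SymC_le_iff intro!: sum.neutral)
  moreover have "((\<lambda>\<epsilon>. Poly_Mapping.lookup (Meixner_eps z z' \<epsilon> \<nu>) m) \<longlongrightarrow>
      Poly_Mapping.lookup (Laguerre z z' \<nu>) m) (at 0)" for m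
  proof -
    have "((\<lambda>\<epsilon>. \<Sum>\<mu>\<in>?I. laguerre_coeff z z' \<nu> \<mu> * (1 - \<epsilon>) ^ (psize \<nu> - psize \<mu>) *
          Poly_Mapping.lookup (FS_eps \<epsilon> \<mu>) m) \<longlongrightarrow>
        (\<Sum>\<mu>\<in>?I. laguerre_coeff z z' \<nu> \<mu> * (1 - 0) ^ (psize \<nu> - psize \<mu>) *
          Poly_Mapping.lookup (complexify (Schur \<mu>)) m)) (at 0)"
      by (intro tendsto_sum tendsto_mult tendsto_power tendsto_diff tendsto_const tendsto_ident_at
          FS_eps_lookup_tendsto) simp
    then have "((\<lambda>\<epsilon>. \<Sum>\<mu>\<in>?I. laguerre_coeff z z' \<nu> \<mu> * (1 - \<epsilon>) ^ (psize \<nu> - psize \<mu>) *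
          Poly_Mapping.lookup (FS_eps \<epsilon> \<mu>) m) \<longlongrightarrow> Poly_Mapping.lookup (Laguerre z z' \<nu>) m) (at 0)"
      by (simp add: lookup_Laguerre)
    moreover have "\<forall>\<^sub>F \<epsilon> in at 0. (\<Sum>\<mu>\<in>?I. laguerre_coeff z z' \<nu> \<mu> * (1 - \<epsilon>) ^ (psize \<nu> - psize \<mu>) *
          Poly_Mapping.lookup (FS_eps \<epsilon> \<mu>) m) = Poly_Mapping.lookup (Meixner_eps z z' \<epsilon> \<nu>) m"
      unfolding eventually_at_filter
      by (intro always_eventually) (simp add: lookup_Meixner_eps[OF assms])
    ultimately show ?thesis by (rule Lim_transform_eventually)
  qed
  ultimately show "converges_in_SymC_le (psize \<nu>) (\<lambda>\<epsilon>. Meixner_eps z z' \<epsilon> \<nu>) (Laguerre z z' \<nu>)"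
    by (simp add: converges_in_SymC_le_def)
qed

end
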